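(* For every integer $n \ge 1$, let $B_n$ be the braid group on $n$ strands. Then the power orbit problem for $B_n$ is decidable, and the nonnegative power orbit problem for $B_n$ is decidable.
   Context: The power orbit problem in a group $G$ is the question: given $x, y \in G$, does there exist $k \in \mathbb{Z}$ such that $x^k = y$? The nonnegative power orbit problem in $G$ is the question: given $x, y \in G$, does there exist $k \in \mathbb{N}$ such that $x^k = y$? Here $\mathbb{N}$ includes $0$. The braid group $B_n$ is given by Artin's presentation: generators $\sigma_1,\dots,\sigma_{n-1}$ with relations $\sigma_i\sigma_j = \sigma_j\sigma_i$ for $|i-j|\ge 2$ and $\sigma_i\sigma_{i+1}\sigma_i = \sigma_{i+1}\sigma_i\sigma_{i+1}$ for $1\le i\le n-2$. Elements of $B_n$ are given as words in the $\sigma_i^{\pm 1}$. "Decidable" means that there is an algorithm (Turing machine) that halts on every input and answers correctly. *)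

theory Defs
  imports "HOL-Algebra.Group"
begin

section \<open>Groups given by presentations\<close>

text \<open>A letter \<open>(g, True)\<close> stands for the generator \<open>g\<close>, and \<open>(g, False)\<close> for its inverse.\<close>

type_synonym 'g word = "('g \<times> bool) list"

definition letters :: "'g set \<Rightarrow> ('g \<times> bool) set" where
  "letters X = X \<times> UNIV"

inductive pres_eq :: "'g set \<Rightarrow> ('g word \<times> 'g word) set \<Rightarrow> 'g word \<Rightarrow> 'g word \<Rightarrow> bool"
  for X :: "'g set" and R :: "('g word \<times> 'g word) set" where
  refl: "w \<in> lists (letters X) \<Longrightarrow> pres_eq X R w w"
| sym: "pres_eq X R u v \<Longrightarrow> pres_eq X R v u"
| trans: "pres_eq X R u v \<Longrightarrow> pres_eq X R v w \<Longrightarrow> pres_eq X R u w"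
| cong: "pres_eq X R u v \<Longrightarrow> a \<in> lists (letters X) \<Longrightarrow> b \<in> lists (letters X) \<Longrightarrow>
    pres_eq X R (a @ u @ b) (a @ v @ b)"
| cancel: "g \<in> X \<Longrightarrow> pres_eq X R [(g, s), (g, \<not> s)] []"
| relator: "(u, v) \<in> R \<Longrightarrow> u \<in> lists (letters X) \<Longrightarrow> v \<in> lists (letters X) \<Longrightarrow> pres_eq X R u v"

definition pres_class :: "'g set \<Rightarrow> ('g word \<times> 'g word) set \<Rightarrow> 'g word \<Rightarrow> 'g word set" where
  "pres_class X R w = {v. pres_eq X R w v}"

definition presented_group :: "'g set \<Rightarrow> ('g word \<times> 'g word) set \<Rightarrow> 'g word set monoid" where
  "presented_group X R =
    \<lparr> carrier = pres_class X R ` lists (letters X),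
      mult = (\<lambda>A B. \<Union>a\<in>A. \<Union>b\<in>B. pres_class X R (a @ b)),
      one = pres_class X R [] \<rparr>"

lemma pres_eq_words:
  "pres_eq X R u v \<Longrightarrow> u \<in> lists (letters X) \<and> v \<in> lists (letters X)"
  by (induction rule: pres_eq.induct) (auto simp: letters_def)

lemma pres_class_eq_iff:
  assumes "u \<in> lists (letters X)"
  shows "pres_class X R u = pres_class X R v \<longleftrightarrow> pres_eq X R u v"
  using assms unfolding pres_class_def set_eq_iff mem_Collect_eq
  by (meson pres_eq.refl pres_eq.sym pres_eq.trans)

lemma pres_eq_append:
  assumes "pres_eq X R u u'" "pres_eq X R v v'"
  shows "pres_eq X R (u @ v) (u' @ v')"
proof -
  have "pres_eq X R ([] @ u @ v) ([] @ u' @ v)"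
    by (rule pres_eq.cong) (use assms pres_eq_words[OF assms(1)] pres_eq_words[OF assms(2)] in auto)
  moreover have "pres_eq X R (u' @ v @ []) (u' @ v' @ [])"
    by (rule pres_eq.cong) (use assms pres_eq_words[OF assms(1)] pres_eq_words[OF assms(2)] in auto)
  ultimately show ?thesis by (auto intro: pres_eq.trans)
qed

lemma presented_group_mult:
  assumes "u \<in> lists (letters X)" "v \<in> lists (letters X)"
  shows "pres_class X R u \<otimes>\<^bsub>presented_group X R\<^esub> pres_class X R v = pres_class X R (u @ v)"
proof -
  have "pres_class X R (a @ b) = pres_class X R (u @ v)"
    if "pres_eq X R u a" "pres_eq X R v b" for a b
    using pres_class_eq_iff[of "u @ v" X R "a @ b"] pres_eq_append[OF that] assms by simp
  then show ?thesis
    using assms by (auto simp: presented_group_def pres_class_def intro: pres_eq.refl)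
qed

lemma pres_eq_inverse:
  assumes "w \<in> lists (letters X)"
  shows "pres_eq X R (rev (map (\<lambda>(g, s). (g, \<not> s)) w) @ w) []"
  using assms
proof (induction w)
  case Nil
  then show ?case by (simp add: pres_eq.refl)
next
  case (Cons l w)
  obtain g s where l: "l = (g, s)" by fastforce
  let ?i = "rev (map (\<lambda>(g, s). (g, \<not> s)) w)"
  have w: "w \<in> lists (letters X)" and g: "g \<in> X"
    using Cons l by (auto simp: letters_def)
  have "?i \<in> lists (letters X)"
    using w by (auto simp: letters_def)
  then have step: "pres_eq X R (?i @ [(g, \<not> s), (g, \<not> \<not> s)] @ w) (?i @ [] @ w)"
    using w g by (intro pres_eq.cong pres_eq.cancel)
  have "pres_eq X R (?i @ w) []"
    using Cons w by simp
  with step have "pres_eq X R (?i @ [(g, \<not> s), (g, \<not> \<not> s)] @ w) []"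
    by (auto intro: pres_eq.trans)
  then show ?case
    by (simp add: l)
qed

lemma group_presented_group: "group (presented_group X R)"
proof (rule groupI)
  let ?G = "presented_group X R"
  have car: "x \<in> carrier ?G \<longleftrightarrow> (\<exists>w \<in> lists (letters X). x = pres_class X R w)" for x
    unfolding presented_group_def by auto
  have app: "u @ v \<in> lists (letters X)" if "u \<in> lists (letters X)" "v \<in> lists (letters X)" for u v
    using that by simp
  show "x \<otimes>\<^bsub>?G\<^esub> y \<in> carrier ?G" if "x \<in> carrier ?G" "y \<in> carrier ?G" for x y
    using that by (metis car app presented_group_mult)
  show "x \<otimes>\<^bsub>?G\<^esub> y \<otimes>\<^bsub>?G\<^esub> z = x \<otimes>\<^bsub>?G\<^esub> (y \<otimes>\<^bsub>?G\<^esub> z)"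
    if "x \<in> carrier ?G" "y \<in> carrier ?G" "z \<in> carrier ?G" for x y z
    using that by (metis car app append_assoc presented_group_mult)
next
  show "\<one>\<^bsub>presented_group X R\<^esub> \<in> carrier (presented_group X R)"
    by (simp add: presented_group_def)
next
  fix x assume "x \<in> carrier (presented_group X R)"
  then obtain w where w: "w \<in> lists (letters X)" "x = pres_class X R w"
    by (auto simp: presented_group_def)
  have one: "\<one>\<^bsub>presented_group X R\<^esub> = pres_class X R []"
    by (simp add: presented_group_def)
  show "\<one>\<^bsub>presented_group X R\<^esub> \<otimes>\<^bsub>presented_group X R\<^esub> x = x"
    using w presented_group_mult[of "[]" X w R] by (simp add: one)
  let ?i = "rev (map (\<lambda>(g, s). (g, \<not> s)) w)"
  have i: "?i \<in> lists (letters X)"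
    using w by (auto simp: letters_def)
  have "pres_class X R ?i \<otimes>\<^bsub>presented_group X R\<^esub> x = \<one>\<^bsub>presented_group X R\<^esub>"
    using pres_eq_inverse[OF w(1), of R] i w pres_eq_words
    by (simp add: one presented_group_mult pres_class_eq_iff)
  moreover have "pres_class X R ?i \<in> carrier (presented_group X R)"
    using i unfolding presented_group_def by simp
  ultimately show "\<exists>y\<in>carrier (presented_group X R).
      y \<otimes>\<^bsub>presented_group X R\<^esub> x = \<one>\<^bsub>presented_group X R\<^esub>"
    by blast
qed

section \<open>Braid groups\<close>

definition braid_gens :: "nat \<Rightarrow> nat set" where
  "braid_gens n = {1..<n}"

definition braid_relations :: "nat \<Rightarrow> (nat word \<times> nat word) set" where
  "braid_relations n =
    {([(i, True), (j, True)], [(j, True), (i, True)]) | i j.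
       i \<in> braid_gens n \<and> j \<in> braid_gens n \<and> \<bar>int i - int j\<bar> \<ge> 2} \<union>
    {([(i, True), (i + 1, True), (i, True)], [(i + 1, True), (i, True), (i + 1, True)]) | i.
       i \<in> braid_gens n \<and> i + 1 \<in> braid_gens n}"

definition braid_group :: "nat \<Rightarrow> nat word set monoid" where
  "braid_group n = presented_group (braid_gens n) (braid_relations n)"

definition braid_of_word :: "nat \<Rightarrow> nat word \<Rightarrow> nat word set" where
  "braid_of_word n = pres_class (braid_gens n) (braid_relations n)"

section \<open>Deterministic multitape Turing machines\<close>

text \<open>Tapes are infinite in both directions. The tape alphabet contains the blank, the
  input symbols, and possibly further work symbols.\<close>

datatype 'a tape_symbol = Blank | Input 'a | Work nat

datatype head_move = Left_Move | Stay | Right_Move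

record 'a turing_machine =
  tm_tapes :: nat
  tm_states :: "nat set"
  tm_alphabet :: "'a tape_symbol set"
  tm_start :: nat
  tm_accept :: nat
  tm_reject :: nat
  tm_delta :: "nat \<Rightarrow> 'a tape_symbol list \<Rightarrow> nat \<times> ('a tape_symbol \<times> head_move) list"

definition tm_wf :: "'a set \<Rightarrow> 'a turing_machine \<Rightarrow> bool" where
  "tm_wf A M \<longleftrightarrow>
    tm_tapes M \<ge> 1 \<and> finite (tm_states M) \<and> finite (tm_alphabet M) \<and>
    insert Blank (Input ` A) \<subseteq> tm_alphabet M \<and>
    {tm_start M, tm_accept M, tm_reject M} \<subseteq> tm_states M \<and> tm_accept M \<noteq> tm_reject M \<and>
    (\<forall>q \<in> tm_states M. \<forall>ss \<in> lists (tm_alphabet M). length ss = tm_tapes M \<longrightarrow>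
      fst (tm_delta M q ss) \<in> tm_states M \<and>
      snd (tm_delta M q ss) \<in> lists (tm_alphabet M \<times> UNIV) \<and>
      length (snd (tm_delta M q ss)) = tm_tapes M)"

text \<open>A tape is its content together with the position of the head; a configuration is a
  state together with the list of tapes.\<close>

type_synonym 'a tape = "(int \<Rightarrow> 'a tape_symbol) \<times> int"
type_synonym 'a config = "nat \<times> 'a tape list"

fun move_head :: "head_move \<Rightarrow> int \<Rightarrow> int" where
  "move_head Left_Move p = p - 1"
| "move_head Stay p = p"
| "move_head Right_Move p = p + 1"

fun read_tape :: "'a tape \<Rightarrow> 'a tape_symbol" where
  "read_tape (c, p) = c p"

fun write_tape :: "'a tape \<Rightarrow> 'a tape_symbol \<times> head_move \<Rightarrow> 'a tape" where
  "write_tape (c, p) (s, m) = (c(p := s), move_head m p)"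

definition tm_step :: "'a turing_machine \<Rightarrow> 'a config \<Rightarrow> 'a config" where
  "tm_step M = (\<lambda>(q, ts).
    if q = tm_accept M \<or> q = tm_reject M then (q, ts)
    else let (q', acts) = tm_delta M q (map read_tape ts) in (q', map2 write_tape ts acts))"

definition input_tape :: "'a list \<Rightarrow> 'a tape" where
  "input_tape w = ((\<lambda>p. if 0 \<le> p \<and> p < int (length w) then Input (w ! nat p) else Blank), 0)"

definition tm_init :: "'a turing_machine \<Rightarrow> 'a list \<Rightarrow> 'a config" where
  "tm_init M w = (tm_start M, input_tape w # replicate (tm_tapes M - 1) (\<lambda>_. Blank, 0))"

definition tm_accepts :: "'a turing_machine \<Rightarrow> 'a list \<Rightarrow> bool" where
  "tm_accepts M w \<longleftrightarrow> (\<exists>t. fst ((tm_step M ^^ t) (tm_init M w)) = tm_accept M)"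

definition tm_rejects :: "'a turing_machine \<Rightarrow> 'a list \<Rightarrow> bool" where
  "tm_rejects M w \<longleftrightarrow> (\<exists>t. fst ((tm_step M ^^ t) (tm_init M w)) = tm_reject M)"

definition decidable_language :: "'a set \<Rightarrow> 'a list set \<Rightarrow> bool" where
  "decidable_language A L \<longleftrightarrow> finite A \<and> L \<subseteq> lists A \<and>
    (\<exists>M :: 'a turing_machine. tm_wf A M \<and>
      (\<forall>w \<in> lists A. (w \<in> L \<longrightarrow> tm_accepts M w) \<and> (w \<notin> L \<longrightarrow> tm_rejects M w)))"

text \<open>A pair of words is presented to a machine as \<open>x # y\<close>, where the separator \<open>#\<close> is the
  symbol \<^const>\<open>None\<close>.\<close>

definition encode_pair :: "'a list \<Rightarrow> 'a list \<Rightarrow> 'a option list" where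
  "encode_pair x y = map Some x @ [None] @ map Some y"

definition decidable_on_pairs :: "'a set \<Rightarrow> ('a list \<Rightarrow> 'a list \<Rightarrow> bool) \<Rightarrow> bool" where
  "decidable_on_pairs A P \<longleftrightarrow>
    decidable_language (insert None (Some ` A))
      {encode_pair x y | x y. x \<in> lists A \<and> y \<in> lists A \<and> P x y}"

section \<open>Power orbit problems\<close>

definition in_power_orbit :: "('a, 'b) monoid_scheme \<Rightarrow> 'a \<Rightarrow> 'a \<Rightarrow> bool" where
  "in_power_orbit G x y \<longleftrightarrow> (\<exists>k :: int. x [^]\<^bsub>G\<^esub> k = y)"

definition in_nonneg_power_orbit :: "('a, 'b) monoid_scheme \<Rightarrow> 'a \<Rightarrow> 'a \<Rightarrow> bool" where
  "in_nonneg_power_orbit G x y \<longleftrightarrow> (\<exists>k :: nat. x [^]\<^bsub>G\<^esub> k = y)"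

definition braid_power_orbit_decidable :: "nat \<Rightarrow> bool" where
  "braid_power_orbit_decidable n \<longleftrightarrow>
    decidable_on_pairs (letters (braid_gens n))
      (\<lambda>x y. in_power_orbit (braid_group n) (braid_of_word n x) (braid_of_word n y))"

definition braid_nonneg_power_orbit_decidable :: "nat \<Rightarrow> bool" where
  "braid_nonneg_power_orbit_decidable n \<longleftrightarrow>
    decidable_on_pairs (letters (braid_gens n))
      (\<lambda>x y. in_nonneg_power_orbit (braid_group n) (braid_of_word n x) (braid_of_word n y))"

end

theory Submission
  imports Defs "HOL-Combinatorics.Permutations"
begin

text \<open>
  Let the braid group act on the free group by Artin's automorphisms. Every braid on \<open>n\<close> strands is a
  product \<open>h a c\<close>, where \<open>h\<close> is a braid on \<open>n - 1\<close> strands, \<open>a\<close> is a word \<open>g\<close> in the \<open>n - 1\<close> loops of the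
  last strand around the others, and \<open>c\<close> is one of \<open>n\<close> coset representatives, trivial if the braid is
  pure. Killing the generator \<open>x\<^sub>n\<close> recovers the action of \<open>h\<close> on the smaller free group, and \<open>a\<close> sends
  \<open>x\<^sub>n\<close> to \<open>u\<inverse> x\<^sub>n u\<close>, where \<open>u\<close> becomes \<open>g\<close> once \<open>x\<^sub>n\<close> is killed. As \<open>g\<^sup>k\<close> has length at least \<open>k\<close> for
  \<open>g \<noteq> 1\<close>, induction on \<open>n\<close> shows that a pure braid \<open>x\<close> is trivial, or that some generator has an image of
  length at least \<open>k\<close> under \<open>x\<^sup>k\<close>, for every \<open>k\<close>. This gives the faithfulness of the action, and thereby
  a solution of the word problem. It also gives a bound on the exponent: the image of a generator
  under a braid word \<open>y\<close> has length at most \<open>3\<^bsup>|y|\<^esup>\<close>, and a fixed power of every braid is pure, so if \<open>y\<close>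
  is a power of \<open>x\<close> at all, then it is one with an exponent at most exponential in \<open>|y|\<close>. A Turing
  machine can try all these exponents.
\<close>

section \<open>Groups of bijections and evaluation of words\<close>

text \<open>The combing is a computation on words and does not depend on the group in which they are
  evaluated. Hence one triple \<open>(h, g, j)\<close> is correct at once in every group that
  satisfies the braid relations: for the transpositions \<open>tau\<close>, for Artin's
  automorphisms \<open>sigma\<close>, and for the braid group acting on itself. This takes the place
  of structural knowledge about the braid group: neither uniqueness of the decomposition nor
  freeness of the loops is established there beforehand. Permutations force \<open>j = n\<close> for
  pure braids; the automorphisms either grow or force the loop word and \<open>h\<close> to be
  trivial, and then the word is trivial in the braid group too. Nor is torsion excluded: if the pure
  power \<open>x^M\<close> is trivial, exponents are reduced modulo \<open>M\<close> instead. All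
  groups are written additively, in the noncommutative class \<open>group_add\<close>, and
  \<open>f + g\<close> applies \<open>g\<close> first.\<close>

typedef 'a symm = "{f :: 'a \<Rightarrow> 'a. bij f}" morphisms app Symm
  by (auto intro: bij_id)

setup_lifting type_definition_symm

instantiation symm :: (type) group_add
begin

lift_definition zero_symm :: "'a symm" is "id"
  by simp

lift_definition plus_symm :: "'a symm \<Rightarrow> 'a symm \<Rightarrow> 'a symm" is "\<lambda>f g. f \<circ> g"
  by (rule bij_comp)

lift_definition uminus_symm :: "'a symm \<Rightarrow> 'a symm" is "\<lambda>f. inv_into UNIV f"
  by (rule bij_imp_bij_inv)

definition minus_symm :: "'a symm \<Rightarrow> 'a symm \<Rightarrow> 'a symm" where
  "minus_symm f g = f + - g"

instance
proof
  fix a b c :: "'a symm"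
  show "a + b + c = a + (b + c)"
    by transfer auto
  show "0 + a = a" "a + 0 = a"
    by (transfer, simp)+
  show "- a + a = 0"
    by transfer (simp add: bij_is_inj)
  show "a + - b = a - b"
    by (simp add: minus_symm_def)
qed

end

lemma app_zero [simp]: "app 0 x = x"
  by transfer simp

lemma app_plus [simp]: "app (f + g) x = app f (app g x)"
  by transfer simp

lemma app_uminus_app [simp]: "app (- f) (app f x) = x" "app f (app (- f) x) = x"
  by (metis app_plus app_zero left_minus, metis app_plus app_zero right_minus)

lemma symm_eqI: "(\<And>x. app f x = app g x) \<Longrightarrow> f = g"
  by (rule iffD1[OF app_inject]) (rule ext)

lemma app_Symm:
  assumes "\<And>x. g (f x) = x" "\<And>x. f (g x) = x"
  shows "app (Symm f) = f"
proof -
  have "bij f"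
    by (rule o_bij[of g]) (auto simp: assms)
  then show ?thesis
    by (simp add: Symm_inverse)
qed

section \<open>Multiples and values of words in an additively written group\<close>

definition nmul :: "nat \<Rightarrow> 'g::monoid_add \<Rightarrow> 'g" where
  "nmul k g = sum_list (replicate k g)"

lemma nmul_0 [simp]: "nmul 0 g = 0"
  and nmul_Suc: "nmul (Suc k) g = g + nmul k g"
  by (simp_all add: nmul_def)

lemma nmul_zero [simp]: "nmul k 0 = 0"
  by (induction k) (simp_all add: nmul_Suc)

lemma nmul_one [simp]: "nmul (Suc 0) g = g"
  by (simp add: nmul_Suc)

lemma nmul_add: "nmul (k + l) g = nmul k g + nmul l g"
  by (simp add: nmul_def replicate_add)

lemma nmul_mult: "nmul (k * l) g = nmul k (nmul l g)"
  by (induction k) (simp_all add: nmul_Suc nmul_add)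

lemma nmul_conj: "nmul k (- a + g + a) = - a + nmul k g + (a :: 'g::group_add)"
proof (induction k)
  case (Suc k)
  then show ?case
    by (simp add: nmul_Suc add.assoc)
qed simp

type_synonym letter = "nat \<times> bool"

definition flip :: "'g \<times> bool \<Rightarrow> 'g \<times> bool" where
  "flip = (\<lambda>(g, s). (g, \<not> s))"

lemma flip_simp [simp]: "flip (g, s) = (g, \<not> s)"
  by (simp add: flip_def)

lemma fst_flip [simp]: "fst (flip a) = fst a"
  by (cases a) simp

lemma flip_flip [simp]: "flip (flip a) = a"
  by (cases a) simp

definition winv :: "'g word \<Rightarrow> 'g word" where
  "winv w = rev (map flip w)"

lemma winv_simps [simp]: "winv [] = []" "winv (a # w) = winv w @ [flip a]"
  "winv (u @ v) = winv v @ winv u" "winv w = [] \<longleftrightarrow> w = []" "length (winv w) = length w"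
  by (simp_all add: winv_def)

definition lval :: "('i \<Rightarrow> 'g::group_add) \<Rightarrow> 'i \<times> bool \<Rightarrow> 'g" where
  "lval s = (\<lambda>(i, b). if b then s i else - s i)"

lemma lval_simp [simp]: "lval s (i, b) = (if b then s i else - s i)"
  by (simp add: lval_def)

lemma lval_flip [simp]: "lval s (flip a) = - lval s a"
  by (cases a) simp

definition wval :: "('i \<Rightarrow> 'g::group_add) \<Rightarrow> 'i word \<Rightarrow> 'g" where
  "wval s w = sum_list (map (lval s) w)"

lemma wval_simps [simp]: "wval s [] = 0" "wval s (a # w) = lval s a + wval s w"
  "wval s (u @ v) = wval s u + wval s v"
  by (simp_all add: wval_def)

lemma wval_winv [simp]: "wval s (winv w) = - wval s w"
  by (induction w) (simp_all add: minus_add)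

lemma wval_replicate [simp]: "wval s (concat (replicate k w)) = nmul k (wval s w)"
  by (induction k) (simp_all add: nmul_Suc)

lemma wval_pres_eq:
  assumes "pres_eq X R u v"
    and "\<And>u v. (u, v) \<in> R \<Longrightarrow> u \<in> lists (letters X) \<Longrightarrow> v \<in> lists (letters X) \<Longrightarrow> wval s u = wval s v"
  shows "wval s u = wval s v"
  using assms(1) by induction (simp_all add: assms(2))

section \<open>The free group on the natural numbers\<close>

lemma in_lists_letters_UNIV [simp]: "w \<in> lists (letters UNIV)"
  by (simp add: letters_def)

\<comment> \<open>One free group of infinite rank serves all \<open>n\<close>: the free group for
  fewer strands lies inside it without an embedding, which the induction on \<open>n\<close>
  exploits.\<close>
quotient_type free = "nat word" / "pres_eq UNIV {}"
proof (rule equivpI)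
  show "reflp (pres_eq UNIV ({} :: (nat word \<times> nat word) set))"
    by (rule reflpI) (rule pres_eq.refl, simp)
  show "symp (pres_eq UNIV ({} :: (nat word \<times> nat word) set))"
    by (rule sympI) (rule pres_eq.sym)
  show "transp (pres_eq UNIV ({} :: (nat word \<times> nat word) set))"
    by (rule transpI) (rule pres_eq.trans)
qed

lemma pres_eq_winv: "w \<in> lists (letters X) \<Longrightarrow> pres_eq X R (winv w @ w) []"
  using pres_eq_inverse[of w X R] by (simp add: winv_def flip_def)

lemma winv_in_lists [simp]: "winv w \<in> lists (letters X) \<longleftrightarrow> w \<in> lists (letters X)"
  by (induction w) (auto simp: letters_def mem_Times_iff)

text \<open>In the quotient,
  \<open>winv u = winv u @ v @ winv v = winv u @ u @ winv v = winv v\<close>.\<close>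

lemma pres_eq_winv_cong:
  assumes "pres_eq X R u v"
  shows "pres_eq X R (winv u) (winv v)"
proof -
  have w: "u \<in> lists (letters X)" "v \<in> lists (letters X)"
    using pres_eq_words[OF assms] by auto
  have iu: "pres_eq X R (winv u @ u) []" and iv: "pres_eq X R (winv (winv v) @ winv v) []"
    by (intro pres_eq_winv winv_in_lists[THEN iffD2] w)+
  have "winv (winv v) = v"
    by (induction v) auto
  then have "pres_eq X R (v @ winv v) []"
    using iv by simp
  moreover have "pres_eq X R ((winv u @ u) @ winv v) ([] @ winv v)"
    by (intro pres_eq_append iu pres_eq.refl) (use w in simp)
  moreover have "pres_eq X R (winv u @ (u @ winv v)) (winv u @ (v @ winv v))"
    by (intro pres_eq_append assms pres_eq.refl) (use w in simp_all)
  moreover have "pres_eq X R (winv u @ (v @ winv v)) (winv u @ [])"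
    by (intro pres_eq_append calculation pres_eq.refl) (use w in simp)
  ultimately show ?thesis
    by simp (meson pres_eq.trans pres_eq.sym)
qed

instantiation free :: group_add
begin

lift_definition zero_free :: free is "[]" .

lift_definition plus_free :: "free \<Rightarrow> free \<Rightarrow> free" is "\<lambda>u v. u @ v"
  by (rule pres_eq_append)

lift_definition uminus_free :: "free \<Rightarrow> free" is winv
  by (rule pres_eq_winv_cong)

definition minus_free :: "free \<Rightarrow> free \<Rightarrow> free" where
  "minus_free f g = f + - g"

instance
proof
  fix a b c :: free
  show "a + b + c = a + (b + c)" "0 + a = a" "a + 0 = a"
    by (transfer, simp add: pres_eq.refl)+
  show "- a + a = 0"
    by transfer (simp add: pres_eq_winv)
  show "a + - b = a - b"
    by (simp add: minus_free_def)
qed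

end

lift_definition gen :: "nat \<Rightarrow> free" is "\<lambda>i. [(i, True)]" .

lift_definition fval :: "(nat \<Rightarrow> 'g::group_add) \<Rightarrow> free \<Rightarrow> 'g" is wval
  by (auto dest: wval_pres_eq)

lemma fval_zero [simp]: "fval s 0 = 0"
  by transfer simp

lemma fval_gen [simp]: "fval s (gen i) = s i"
  by transfer simp

lemma fval_plus [simp]: "fval s (g + h) = fval s g + fval s h"
  by transfer simp

lemma fval_uminus [simp]: "fval s (- g) = - fval s g"
  by transfer simp

lemma fval_diff [simp]: "fval s (g - h) = fval s g - fval s h"
  by (metis fval_plus fval_uminus diff_conv_add_uminus)

lemma fval_nmul [simp]: "fval s (nmul k g) = nmul k (fval s g)"
  by (induction k) (simp_all add: nmul_Suc)

lemma abs_free_Cons: "abs_free (a # w) = lval gen a + abs_free w"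
proof (cases a)
  case (Pair i b)
  have "abs_free [(i, False)] = - gen i"
    by (simp add: gen.abs_eq uminus_free.abs_eq)
  then have "abs_free [a] = lval gen a"
    using Pair by (simp add: gen.abs_eq)
  moreover have "abs_free (a # w) = abs_free [a] + abs_free w"
    by (simp add: plus_free.abs_eq)
  ultimately show ?thesis
    by simp
qed

lemma abs_free_eq_wval: "abs_free w = wval gen w"
  by (induction w) (simp_all add: abs_free_Cons flip: zero_free_def)

lemma free_word: "\<exists>w. g = wval gen w"
  by (metis abs_free_eq_wval Quotient_free Quotient_abs_rep)

lemma free_induct [case_names zero plus minus]:
  assumes "P 0" "\<And>i g. P g \<Longrightarrow> P (gen i + g)" "\<And>i g. P g \<Longrightarrow> P (- gen i + g)"
  shows "P g"
proof -
  have "P (wval gen w)" for w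
    by (induction w) (use assms in \<open>auto simp: lval_def\<close>)
  then show ?thesis
    using free_word by metis
qed

lemma fval_wval_gen [simp]: "fval s (wval gen w) = wval s w"
  by (induction w) (auto simp: lval_def)

lemma hom_zero_uminus:
  fixes h :: "'a::group_add \<Rightarrow> 'b::group_add"
  assumes "\<And>x y. h (x + y) = h x + h y"
  shows "h 0 = 0" "h (- x) = - h x"
proof -
  have "h 0 + h 0 = h 0 + 0"
    using assms[of 0 0] by simp
  then show 0: "h 0 = 0"
    by (rule add_left_imp_eq)
  have "h x + h (- x) = 0"
    using assms[of x "- x"] 0 by simp
  then show "h (- x) = - h x"
    using minus_unique by metis
qed

lemma fval_unique:
  fixes h :: "free \<Rightarrow> 'g::group_add"
  assumes "\<And>x y. h (x + y) = h x + h y" and "\<And>i. h (gen i) = s i"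
  shows "h g = fval s g"
  by (induction g rule: free_induct) (simp_all add: assms hom_zero_uminus[of h, OF assms(1)])

lemma fval_fval: "fval s (fval t g) = fval (\<lambda>i. fval s (t i)) g"
  by (rule fval_unique[where h = "\<lambda>g. fval s (fval t g)"]) simp_all

lemma fval_gen_id [simp]: "fval gen g = g"
  by (rule fval_unique[where h = "\<lambda>g. g", symmetric]) simp_all

subsection \<open>Reduced words\<close>

fun push :: "'g \<times> bool \<Rightarrow> 'g word \<Rightarrow> 'g word" where
  "push a [] = [a]"
| "push a (b # w) = (if b = flip a then w else a # b # w)"

definition red :: "'g word \<Rightarrow> 'g word" where
  "red w = foldr push w []"

abbreviation reduced :: "'g word \<Rightarrow> bool" where
  "reduced \<equiv> successively (\<lambda>a b. b \<noteq> flip a)"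

lemma reduced_push: "reduced w \<Longrightarrow> reduced (push a w)"
  by (cases w) (auto simp: successively_Cons)

lemma reduced_foldr_push: "reduced w \<Longrightarrow> reduced (foldr push u w)"
  by (induction u) (simp_all add: reduced_push)

lemma reduced_red: "reduced (red w)"
  unfolding red_def by (rule reduced_foldr_push) simp

lemma push_push_flip: "reduced w \<Longrightarrow> push a (push (flip a) w) = w"
  by (cases w rule: remdups_adj.cases) auto

text \<open>Van der Waerden's argument: by \<open>push_push_flip\<close> each letter permutes the
  reduced words, with the flipped letter as its inverse. So words that are equal in the free group
  act alike, and their action on the empty word is a well-defined normal form.\<close>

lemma foldr_push_cong:
  "pres_eq UNIV {} u v \<Longrightarrow> reduced w \<Longrightarrow> foldr push u w = foldr push v w"
proof (induction arbitrary: w rule: pres_eq.induct)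
  case (cong u v a b)
  then show ?case
    by (simp add: reduced_foldr_push)
next
  case (cancel g s)
  then show ?case
    using push_push_flip[of w "(g, s)"] by simp
qed simp_all

lemma red_of_reduced: "reduced w \<Longrightarrow> red w = w"
proof (induction w)
  case (Cons a w)
  then show ?case
    by (cases w) (auto simp: red_def)
qed (simp add: red_def)

lemma wval_push [simp]: "wval s (push a w) = lval s a + wval s w"
  by (cases w) (simp_all add: add.assoc[symmetric])

lemma wval_red [simp]: "wval s (red w) = wval s w"
  by (induction w) (simp_all add: red_def)

lemma length_push: "length (push a w) \<le> Suc (length w)"
  by (cases w) auto

lemma length_red: "length (red w) \<le> length w"
proof (induction w)
  case (Cons a w)
  have "length (red (a # w)) \<le> Suc (length (red w))"
    using length_push by (simp add: red_def)
  with Cons show ?case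
    by simp
qed (simp add: red_def)

lift_definition nf :: "free \<Rightarrow> nat word" is red
  unfolding red_def by (simp add: foldr_push_cong)

definition len :: "free \<Rightarrow> nat" where
  "len g = length (nf g)"

lemma nf_wval: "nf (wval gen w) = red w"
  by (simp add: nf.abs_eq flip: abs_free_eq_wval)

lemma wval_nf [simp]: "wval gen (nf g) = g"
  by (metis free_word nf_wval wval_red)

lemma wval_nf_fval [simp]: "wval s (nf g) = fval s g"
  by (metis fval_wval_gen wval_nf)

lemma reduced_nf: "reduced (nf g)"
  by (metis free_word nf_wval reduced_red)

lemma red_eq_Nil_iff: "red w = [] \<longleftrightarrow> wval gen w = 0"
  by (metis nf_wval red_def foldr_Nil id_apply wval_red wval_simps(1))

lemma len_wval_reduced: "reduced w \<Longrightarrow> len (wval gen w) = length w"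
  by (simp add: len_def nf_wval red_of_reduced)

lemma len_wval_le: "len (wval gen w) \<le> length w"
  by (simp add: len_def nf_wval length_red)

lemma len_add: "len (g + h) \<le> len g + len h"
  using len_wval_le[of "nf g @ nf h"] by (simp add: len_def)

lemma len_uminus: "len (- g) \<le> len g"
  using len_wval_le[of "winv (nf g)"] by (simp add: len_def)

lemma len_zero [simp]: "len 0 = 0"
  using len_wval_le[of "[]"] by simp

lemma len_gen [simp]: "len (gen i) = 1"
  using len_wval_reduced[of "[(i, True)]"] by simp

lemma len_wval_fval:
  assumes "\<And>i. len (s i) \<le> B"
  shows "len (wval s w) \<le> B * length w"
proof (induction w)
  case (Cons a w)
  have "len (lval s a) \<le> B"
    using assms len_uminus[of "s (fst a)"] by (cases a) (auto intro: order_trans)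
  then show ?case
    using Cons len_add[of "lval s a" "wval s w"] by simp
qed simp

lemma len_fval:
  assumes "\<And>i. len (s i) \<le> B"
  shows "len (fval s g) \<le> B * len g"
  using len_wval_fval[of s B "nf g"] assms by (simp add: len_def)

text \<open>Peeling off mutually inverse end letters leaves a core \<open>c\<close> whose copies can
  be concatenated without cancellation.\<close>

lemma cyclic_reduction:
  assumes "reduced w" "w \<noteq> []"
  shows "\<exists>v c. w = winv v @ c @ v \<and> c \<noteq> [] \<and> hd c \<noteq> flip (last c)"
  using assms
proof (induction w rule: length_induct)
  case (1 w)
  show ?case
  proof (cases "hd w = flip (last w)")
    case True
    then obtain a u where w: "w = flip a # u @ [a]"
      using 1(3) by (cases w; cases "tl w" rule: rev_cases) auto
    have "u \<noteq> []"
      using 1(2) w by auto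
    moreover have "reduced u"
      using 1(2) by (simp add: w successively_Cons successively_append_iff)
    moreover have "length u < length w"
      by (simp add: w)
    ultimately obtain v c where "u = winv v @ c @ v" "c \<noteq> []" "hd c \<noteq> flip (last c)"
      using 1(1) by blast
    then show ?thesis
      by (intro exI[of _ "v @ [a]"] exI[of _ c]) (simp add: w)
  next
    case False
    then show ?thesis
      using 1(3) by (intro exI[of _ "[]"] exI[of _ w]) simp
  qed
qed

text \<open>Between \<open>winv v\<close> and \<open>v\<close>, the \<open>k\<close> copies of the
  cyclically reduced core \<open>c\<close> form a word that is already reduced, and each copy
  contributes at least one letter.\<close>

lemma len_nmul:
  assumes "g \<noteq> 0"
  shows "k \<le> len (nmul k g)"
proof (cases k)
  case (Suc l)
  have "nf g \<noteq> []"
    using assms by (metis wval_nf wval_simps(1))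
  then obtain v c where vc: "nf g = winv v @ c @ v" "c \<noteq> []" "hd c \<noteq> flip (last c)"
    using cyclic_reduction[OF reduced_nf] by blast
  have red: "reduced (winv v @ c @ v)"
    using reduced_nf[of g] vc by simp
  \<comment> \<open>The end letters are part of the induction because they decide whether a further
    copy of \<open>c\<close> cancels.\<close>
  have pow: "reduced (concat (replicate (Suc m) c)) \<and> hd (concat (replicate (Suc m) c)) = hd c
      \<and> last (concat (replicate (Suc m) c)) = last c \<and> concat (replicate (Suc m) c) \<noteq> []" for m
  proof (induction m)
    case 0
    then show ?case
      using red vc by (simp add: successively_append_iff)
  next
    case (Suc m)
    then show ?case
      using red vc by (subst replicate_Suc) (simp add: successively_append_iff)
  qed
  have "reduced (winv v @ concat (replicate k c) @ v)"
    using red vc pow[of l] Suc by (auto simp: successively_append_iff simp del: replicate_Suc)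
  moreover have "wval gen (winv v @ concat (replicate k c) @ v) = nmul k g"
    using vc(1) wval_nf[of g] nmul_conj[of k "wval gen v" "wval gen c"] by (simp add: add.assoc)
  ultimately have "len (nmul k g) = length (winv v @ concat (replicate k c) @ v)"
    using len_wval_reduced by metis
  moreover have "k \<le> length (concat (replicate k c))"
    using vc(2) by (induction k) (auto simp: Suc_le_eq simp flip: length_greater_0_conv)
  ultimately show ?thesis
    by simp
qed simp

text \<open>Leading letters of \<open>u\<close> with index \<open>n\<close> commute with
  \<open>gen n\<close> and are killed by \<open>s\<close>, so they may be dropped from both sides.
  For the remaining reduced word \<open>v\<close> the conjugate is reduced of length
  \<open>2 * length v + 1\<close>, while \<open>s\<close> sends \<open>v\<close> to an element of
  length at most \<open>length v\<close>.\<close>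

lemma len_conj_gen:
  assumes "\<And>i. len (s i) \<le> 1" "s n = 0"
  shows "len (fval s u) \<le> len (- u + gen n + u)"
proof -
  have "len (wval s w) \<le> len (- wval gen w + gen n + wval gen w)" if "reduced w" for w
    using that
  proof (induction w)
    case (Cons a w)
    show ?case
    proof (cases "fst a = n")
      case True
      have conj: "- lval gen a + gen n + lval gen a = gen n"
        using True by (cases a) (simp add: add.assoc)
      have "- wval gen (a # w) + gen n + wval gen (a # w)
          = - wval gen w + (- lval gen a + gen n + lval gen a) + wval gen w"
        by (simp only: wval_simps minus_add add.assoc)
      then have "- wval gen (a # w) + gen n + wval gen (a # w) = - wval gen w + gen n + wval gen w"
        by (simp only: conj)
      moreover have "wval s (a # w) = wval s w"
        using True assms(2) by (cases a) simp
      moreover have "reduced w"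
        using Cons(2) by (cases w) auto
      ultimately show ?thesis
        using Cons(1) by simp
    next
      case False
      have "reduced (winv (a # w) @ [(n, True)] @ a # w)"
      proof -
        have "reduced (winv (a # w))"
          using Cons(2) unfolding winv_def successively_rev successively_map
          by (rule successively_mono) auto
        moreover have "last (winv (a # w)) = flip a"
          by simp
        ultimately show ?thesis
          using False Cons(2) by (cases a) (auto simp: successively_append_iff successively_Cons
              simp del: winv_simps(2))
      qed
      then have "len (wval gen (winv (a # w) @ [(n, True)] @ a # w)) = 2 * length (a # w) + 1"
        by (subst len_wval_reduced) simp_all
      moreover have "len (wval s (a # w)) \<le> 1 * length (a # w)"
        by (rule len_wval_fval) (rule assms)
      moreover have "wval gen (winv (a # w) @ [(n, True)] @ a # w)
          = - wval gen (a # w) + gen n + wval gen (a # w)"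
        by (simp only: wval_simps wval_winv lval_simp if_True add.assoc add_0_right)
      ultimately show ?thesis
        by simp
    qed
  qed simp
  from this[OF reduced_nf, of u] show ?thesis
    by simp
qed

section \<open>Combing braids\<close>

definition additive :: "('a::group_add \<Rightarrow> 'b::group_add) \<Rightarrow> bool" where
  "additive f \<longleftrightarrow> (\<forall>x y. f (x + y) = f x + f y)"

lemma additiveD:
  assumes "additive f"
  shows "f (x + y) = f x + f y" "f 0 = 0" "f (- x) = - f x"
  using assms hom_zero_uminus[of f] by (auto simp: additive_def)

lemma additive_fval: "additive (fval s)"
  by (simp add: additive_def)

lemma additive_app_plus: "additive (app a) \<Longrightarrow> additive (app b) \<Longrightarrow> additive (app (a + b))"
  by (simp add: additive_def)

lemma additive_app_zero: "additive (app 0)"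
  by (simp add: additive_def)

lemma additive_app_uminus:
  assumes "additive (app a)"
  shows "additive (app (- a))"
  unfolding additive_def
proof (intro allI)
  fix x y
  have "app a (app (- a) (x + y)) = app a (app (- a) x + app (- a) y)"
    by (simp add: additiveD(1)[OF assms])
  then show "app (- a) (x + y) = app (- a) x + app (- a) y"
    by simp
qed

lemma additive_app_wval: "(\<And>i. additive (app (s i))) \<Longrightarrow> additive (app (wval s w))"
  by (induction w) (auto simp: lval_def additive_app_plus additive_app_zero additive_app_uminus)

lemma additive_eqI:
  assumes "additive f" "additive g" "\<And>i. f (gen i) = g (gen i)"
  shows "f x = g x"
  using fval_unique[of f "\<lambda>i. g (gen i)" x] fval_unique[of g "\<lambda>i. g (gen i)" x] assms
  by (simp add: additive_def)

lemma additive_symm_eqI: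
  assumes "additive (app a)" "additive (app b)" "\<And>i. app a (gen i) = app b (gen i)"
  shows "a = b"
  by (rule symm_eqI) (rule additive_eqI[OF assms])

text \<open>This automorphism fixes the product of \<open>gen i\<close> and
  \<open>gen (Suc i)\<close>. Its formula is the one by which conjugation with \<open>s i\<close>
  transforms the loops, see \<open>conj_loop\<close>.\<close>

definition sigma :: "nat \<Rightarrow> free symm" where
  "sigma i = Symm (fval (\<lambda>j. if j = i then gen (Suc i)
     else if j = Suc i then - gen (Suc i) + gen i + gen (Suc i) else gen j))"

lemma app_sigma:
  "app (sigma i) = fval (\<lambda>j. if j = i then gen (Suc i)
     else if j = Suc i then - gen (Suc i) + gen i + gen (Suc i) else gen j)" (is "_ = fval ?f")
  and app_uminus_sigma:
  "app (- sigma i) = fval (\<lambda>j. if j = i then gen i + gen (Suc i) - gen i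
     else if j = Suc i then gen i else gen j)" (is "_ = fval ?g")
proof -
  have 1: "fval ?g (fval ?f x) = x" for x
    by (rule additive_eqI[of "\<lambda>x. fval ?g (fval ?f x)" "\<lambda>x. x"])
      (auto simp: additive_def add.assoc)
  have 2: "fval ?f (fval ?g x) = x" for x
    by (rule additive_eqI[of "\<lambda>x. fval ?f (fval ?g x)" "\<lambda>x. x"])
      (auto simp: additive_def add.assoc)
  show *: "app (sigma i) = fval ?f"
    unfolding sigma_def by (rule app_Symm[OF 1 2])
  have "app (- sigma i) x = fval ?g x" for x
    using app_uminus_app(1)[of "sigma i" "fval ?g x"] unfolding * 2 by simp
  then show "app (- sigma i) = fval ?g"
    by blast
qed

lemma additive_sigma: "additive (app (sigma i))"
  by (simp add: app_sigma additive_fval)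

lemma additive_rho: "additive (app (wval sigma w))"
  by (rule additive_app_wval) (rule additive_sigma)

definition tau :: "nat \<Rightarrow> nat symm" where
  "tau i = Symm (\<lambda>x. if x = i then Suc i else if x = Suc i then i else x)"

lemma app_tau: "app (tau i) = (\<lambda>x. if x = i then Suc i else if x = Suc i then i else x)"
  unfolding tau_def
  by (rule app_Symm[where g = "\<lambda>x. if x = i then Suc i else if x = Suc i then i else x"]) auto

lemma tau_tau [simp]: "tau i + tau i = 0"
  by (rule symm_eqI) (simp add: app_tau)

lemma uminus_tau [simp]: "- tau i = tau i"
  using minus_unique[OF tau_tau] .

text \<open>Passing \<open>p\<close> through \<open>R\<close> turns it into \<open>q\<close>, which
  commutes with \<open>t\<close>. It is applied to loops, with \<open>R\<close> a ramp.\<close>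

lemma commute_through:
  fixes p q R t :: "'g::group_add"
  assumes "p + R = R + q" "q + t = t + q"
  shows "p + (R + (t + t) - R) = R + (t + t) - R + p"
proof -
  have "p + (R + (t + t)) = R + (q + t) + t"
    using assms(1) by (simp add: add.assoc[symmetric])
  also have "\<dots> = R + t + (q + t)"
    using assms(2) by (simp add: add.assoc)
  also have "\<dots> = R + (t + t) + q"
    using assms(2) by (simp add: add.assoc)
  also have "q = - R + (p + R)"
    using assms(1) by simp
  finally have "p + (R + (t + t)) + - R = R + (t + t) + (- R + (p + R)) + - R"
    by (rule arg_cong)
  then show ?thesis
    by (simp add: diff_conv_add_uminus add.assoc del: add_uminus_conv_diff)
qed

text \<open>One move of the combing: a new letter \<open>l\<close> to the right of a combed product
  passes the ramp \<open>r\<close> and becomes \<open>m\<close>, then passes the loop part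
  \<open>f\<close> and turns it into \<open>f'\<close>.\<close>

lemma shift_past:
  fixes r l m f f' H :: "'g::group_add"
  assumes "r + l = m + r" "f + m = m + f'"
  shows "H + f + r + l = H + m + f' + r"
proof -
  have "H + f + r + l = H + (f + m) + r"
    using assms(1) by (simp add: add.assoc)
  then show ?thesis
    using assms(2) by (simp add: add.assoc)
qed

lemma commute_lval: "s i + R = R + s j \<Longrightarrow> lval s (i, b) + R = R + lval s (j, b)"
  for R :: "'g::group_add"
proof -
  assume "s i + R = R + s j"
  then have "- s i + (s i + R) - s j = - s i + (R + s j) - s j"
    by simp
  then have "R - s j = - s i + R"
    by (simp add: diff_conv_add_uminus add.assoc del: add_uminus_conv_diff)
  with \<open>s i + R = R + s j\<close> show ?thesis
    by simp
qed

text \<open>A braid family amounts to a homomorphism from the braid group on \<open>n\<close>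
  strands to an arbitrary group.\<close>

locale braid_family =
  fixes n :: nat and s :: "nat \<Rightarrow> 'g::group_add"
  assumes far: "1 \<le> i \<Longrightarrow> i + 2 \<le> j \<Longrightarrow> j < n \<Longrightarrow> s i + s j = s j + s i"
    and braid: "1 \<le> i \<Longrightarrow> Suc i < n \<Longrightarrow> s i + s (Suc i) + s i = s (Suc i) + s i + s (Suc i)"

lemma braid_family_sigma: "braid_family n sigma"
proof
  fix i j :: nat
  assume "i + 2 \<le> j"
  then show "sigma i + sigma j = sigma j + sigma i"
    by (intro additive_symm_eqI additive_app_plus additive_sigma) (auto simp: app_sigma)
next
  fix i :: nat
  show "sigma i + sigma (Suc i) + sigma i = sigma (Suc i) + sigma i + sigma (Suc i)"
    by (intro additive_symm_eqI additive_app_plus additive_sigma)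
      (auto simp: app_sigma add.assoc minus_add diff_conv_add_uminus simp del: add_uminus_conv_diff)
qed

lemma braid_family_tau: "braid_family n tau"
proof
  fix i j :: nat
  assume "i + 2 \<le> j"
  then show "tau i + tau j = tau j + tau i"
    by (intro symm_eqI) (auto simp: app_tau)
next
  fix i :: nat
  show "tau i + tau (Suc i) + tau i = tau (Suc i) + tau i + tau (Suc i)"
    by (intro symm_eqI) (auto simp: app_tau)
qed

section \<open>Ramps, loops and the combing of words\<close>

definition ramp :: "nat \<Rightarrow> (nat \<Rightarrow> 'g::group_add) \<Rightarrow> nat \<Rightarrow> 'g" where
  "ramp n s j = sum_list (map s (rev [j..<n]))"

lemma ramp_self [simp]: "ramp n s n = 0"
  by (simp add: ramp_def)

lemma ramp_less: "j < n \<Longrightarrow> ramp n s j = ramp n s (Suc j) + s j"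
  by (simp add: ramp_def upt_conv_Cons)

text \<open>The standard pure braid in which the last strand runs once around strand
  \<open>j\<close>. The value 0 at all other indices lets every element of the infinite-rank free
  group be evaluated at the loops.\<close>

definition loop :: "nat \<Rightarrow> (nat \<Rightarrow> 'g::group_add) \<Rightarrow> nat \<Rightarrow> 'g" where
  "loop n s j = (if 1 \<le> j \<and> j < n then ramp n s (Suc j) + (s j + s j) - ramp n s (Suc j) else 0)"

text \<open>A triple \<open>(h, g, j)\<close> stands for
  \<open>wval s h + fval (loop n s) g + ramp n s j\<close>. A letter at the end of the ramp shortens
  or lengthens it and may leave a loop behind, as in
  \<open>ramp n s j + s j = loop n s j + ramp n s (Suc j)\<close>. Any other letter slides to the
  left: through the ramp, where an index above \<open>j\<close> drops by one, and through the loops,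
  on which it acts by Artin's automorphism.\<close>

fun comb_step :: "nat word \<times> free \<times> nat \<Rightarrow> letter \<Rightarrow> nat word \<times> free \<times> nat" where
  "comb_step (h, g, j) (i, b) =
    (if i = j then (h, if b then g + gen j else g, Suc j)
     else if Suc i = j then (h, if b then g else g - gen i, i)
     else let l = (if i < j then i else i - 1, b) in (h @ [l], app (wval sigma [flip l]) g, j))"

definition comb :: "nat \<Rightarrow> nat word \<Rightarrow> nat word \<times> free \<times> nat" where
  "comb n w = foldl comb_step ([], 0, n) w"

context braid_family
begin

lemma ramp_low:
  assumes "1 \<le> i" "i + 1 < j" "j \<le> n"
  shows "s i + ramp n s j = ramp n s j + s i"
  using assms(3,2)
proof (induction j rule: inc_induct)
  case (step j)
  have "s i + ramp n s j = ramp n s (Suc j) + s i + s j"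
    using step by (simp add: ramp_less add.assoc[symmetric])
  then show ?case
    using step far[of i j] assms(1) by (simp add: ramp_less add.assoc)
qed simp

text \<open>The braid relation lowers the index where the letter meets \<open>s (Suc m)\<close> and
  \<open>s m\<close> in the ramp. The lower letters of the ramp are far from
  \<open>s (Suc m)\<close>, the higher ones far from \<open>s m\<close>.\<close>

lemma ramp_high:
  assumes "1 \<le> j" "j \<le> m" "Suc m < n"
  shows "ramp n s j + s (Suc m) = s m + ramp n s j"
  using assms(2,1)
proof (induction j rule: inc_induct)
  case base
  let ?R = "ramp n s (Suc (Suc m))"
  have "ramp n s m + s (Suc m) = ?R + (s (Suc m) + s m + s (Suc m))"
    using assms by (simp add: ramp_less add.assoc)
  also have "\<dots> = ?R + s m + s (Suc m) + s m"
    using braid[of m] assms base by (simp add: add.assoc)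
  also have "\<dots> = s m + ?R + s (Suc m) + s m"
    using ramp_low[of m "Suc (Suc m)"] assms base by simp
  finally show ?case
    using assms by (simp add: ramp_less add.assoc)
next
  case (step j)
  have rl: "ramp n s j = ramp n s (Suc j) + s j"
    using step assms by (simp add: ramp_less)
  have "ramp n s j + s (Suc m) = ramp n s (Suc j) + s (Suc m) + s j"
    using far[of j "Suc m"] step(1,2,4) assms(3) by (simp add: rl add.assoc)
  also have "ramp n s (Suc j) + s (Suc m) = s m + ramp n s (Suc j)"
    using step by simp
  finally show ?case
    by (simp add: rl add.assoc)
qed

text \<open>In multiplicative notation, the neighbouring loops are \<open>R b a a b^-1 R^-1\<close>
  for \<open>i\<close> and \<open>R b b R^-1\<close> for \<open>Suc i\<close>, where
  \<open>a\<close> commutes with \<open>R\<close>; for them everything comes down to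
  \<open>aba = bab\<close>. All other loops commute with \<open>s i\<close>: if
  \<open>j < i\<close>, it passes the ramp as \<open>s (Suc i)\<close>, which is far from
  \<open>s j\<close>.\<close>

lemma conj_loop:
  assumes i: "1 \<le> i" "Suc i < n"
  shows "s i + loop n s j - s i =
    (if j = i then loop n s (Suc i)
     else if j = Suc i then - loop n s (Suc i) + loop n s i + loop n s (Suc i) else loop n s j)"
proof -
  define a b R where "a = s i" and "b = s (Suc i)" and "R = ramp n s (Suc (Suc i))"
  have aR: "a + R = R + a"
    unfolding a_def R_def using ramp_low[of i "Suc (Suc i)"] assms by simp
  have aR': "a + (R + x) = R + (a + x)" for x
    using aR by (simp add: add.assoc[symmetric])
  have aR1: "- R + a = a + - R"
    using arg_cong[OF aR, of "\<lambda>x. - R + x + - R"]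
    by (simp add: add.assoc diff_conv_add_uminus del: add_uminus_conv_diff)
  then have aR1': "- R + (a + x) = a + (- R + x)" for x
    by (simp add: add.assoc[symmetric] del: add_uminus_conv_diff)
  have aba: "a + (b + a) = b + (a + b)"
    unfolding a_def b_def using braid[OF i] by (simp add: add.assoc)
  have aba': "a + (b + (a + x)) = b + (a + (b + x))" for x
    using aba by (simp add: add.assoc[symmetric])
  have Li: "loop n s i = R + (b + (a + (a + (- b + - R))))"
    using assms by (simp add: loop_def a_def b_def R_def ramp_less minus_add add.assoc
        diff_conv_add_uminus del: add_uminus_conv_diff)
  have LSi: "loop n s (Suc i) = R + (b + (b + - R))"
    using assms by (simp add: loop_def a_def b_def R_def add.assoc
        diff_conv_add_uminus del: add_uminus_conv_diff)
  consider "j = i" | "j = Suc i" | "1 \<le> j" "j < i" | "Suc i < j" "j < n" | "\<not> (1 \<le> j \<and> j < n)"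
    by linarith
  then show ?thesis
  proof cases
    case 1
    have "a + loop n s i = loop n s (Suc i) + a"
      unfolding Li LSi add.assoc
      by (simp add: aR' aR1 aR1' aba' del: add_uminus_conv_diff)
    then show ?thesis
      using 1 by (simp add: a_def)
  next
    case 2
    have "loop n s (Suc i) + (a + loop n s (Suc i)) = loop n s i + (loop n s (Suc i) + a)"
      unfolding Li LSi add.assoc
      by (simp add: aR' aR1 aR1' aba' del: add_uminus_conv_diff)
    then have "a + loop n s (Suc i) = - loop n s (Suc i) + (loop n s i + (loop n s (Suc i) + a))"
      by (metis minus_add_cancel)
    then show ?thesis
      using 2 by (simp add: a_def add.assoc diff_conv_add_uminus del: add_uminus_conv_diff)
  next
    case 3
    have "s i + ramp n s (Suc j) = ramp n s (Suc j) + s (Suc i)"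
      using ramp_high[of "Suc j" i] 3 assms by simp
    moreover have "s (Suc i) + s j = s j + s (Suc i)"
      using far[of j "Suc i"] 3 assms by simp
    ultimately have "s i + loop n s j = loop n s j + s i"
      using 3 assms by (simp add: loop_def commute_through)
    then show ?thesis
      using 3 by simp
  next
    case 4
    have "s i + ramp n s (Suc j) = ramp n s (Suc j) + s i"
      using ramp_low[of i "Suc j"] 4 assms by simp
    moreover have "s i + s j = s j + s i"
      using far[of i j] 4 assms by simp
    ultimately have "s i + loop n s j = loop n s j + s i"
      using 4 assms by (simp add: loop_def commute_through)
    then show ?thesis
      using 4 by simp
  next
    case 5
    then show ?thesis
      using assms by (auto simp: loop_def)
  qed
qed

text \<open>The smaller braid group normalises the loop subgroup, by one formula in all families, so
  combing has to update only an element of the free group.\<close>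

lemma conj_fval_loop:
  assumes "1 \<le> i" "Suc i < n"
  shows "s i + fval (loop n s) g - s i = fval (loop n s) (app (sigma i) g)"
proof -
  have "s i + fval (loop n s) g - s i = fval (\<lambda>j. s i + loop n s j - s i) g"
    by (rule fval_unique) (simp_all add: add.assoc diff_conv_add_uminus del: add_uminus_conv_diff)
  also have "\<dots> = fval (\<lambda>j. fval (loop n s) (app (sigma i) (gen j))) g"
    by (rule arg_cong[of _ _ "\<lambda>f. fval f g"]) (rule ext, simp add: conj_loop[OF assms] app_sigma)
  also have "\<dots> = fval (loop n s) (app (sigma i) g)"
    by (simp add: app_sigma fval_fval)
  finally show ?thesis .
qed

lemma conj_fval_loop_letter:
  assumes "1 \<le> fst l" "Suc (fst l) < n"
  shows "lval s l + fval (loop n s) (app (wval sigma [flip l]) g) = fval (loop n s) g + lval s l"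
proof (cases l)
  case (Pair i b)
  have "s i + fval (loop n s) g = fval (loop n s) (app (sigma i) g) + s i" for g
    using conj_fval_loop[of i g] assms Pair by (metis diff_add_cancel fst_conv)
  note c = this this[of "app (- sigma i) g", symmetric]
  show ?thesis
  proof (cases b)
    case True
    then show ?thesis using Pair c(2) by simp
  next
    case False
    have "- s i + fval (loop n s) (app (sigma i) g) = - s i + (s i + fval (loop n s) g - s i)"
      using c(1)[of g] by simp
    then show ?thesis
      using Pair False
      by (simp add: add.assoc diff_conv_add_uminus del: add_uminus_conv_diff)
  qed
qed

lemma comb_correct:
  assumes "1 \<le> n" "w \<in> lists (letters {1..<n})"
  shows "case comb n w of (h, g, j) \<Rightarrow> wval s w = wval s h + fval (loop n s) g + ramp n s j
    \<and> h \<in> lists (letters {1..<n - 1}) \<and> 1 \<le> j \<and> j \<le> n"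
  using assms(2)
proof (induction w rule: rev_induct)
  case Nil
  then show ?case
    using assms(1) by (simp add: comb_def)
next
  case (snoc l w)
  obtain h g j where hgj: "comb n w = (h, g, j)"
    by (cases "comb n w")
  obtain i b where l: "l = (i, b)"
    by fastforce
  have i: "1 \<le> i" "i < n"
    using snoc(2) l by (auto simp: letters_def)
  have IH: "wval s w = wval s h + fval (loop n s) g + ramp n s j"
    and h: "h \<in> lists (letters {1..<n - 1})" and j: "1 \<le> j" "j \<le> n"
    using snoc hgj by auto
  have comb: "comb n (w @ [l]) = comb_step (h, g, j) (i, b)"
    using hgj l by (simp add: comb_def)
  consider "i = j" | "Suc i = j" | "Suc i < j" | "j < i"
    by linarith
  then show ?case
  proof cases
    case 1
    have "loop n s j + ramp n s (Suc j) = ramp n s j + s j"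
      using 1 i by (simp add: loop_def ramp_less add.assoc)
    then show ?thesis
      unfolding comb using 1 i h j IH by (simp add: l add.assoc ramp_less)
  next
    case 2
    have "ramp n s i = ramp n s j + s i"
      using 2 i by (simp add: ramp_less)
    moreover have "- loop n s i + ramp n s i = ramp n s j - s i"
      using 2 i by (simp add: loop_def ramp_less minus_add add.assoc
         diff_conv_add_uminus del: add_uminus_conv_diff)
    ultimately show ?thesis
      unfolding comb using 2 i h j IH by (simp add: l add.assoc
         diff_conv_add_uminus del: add_uminus_conv_diff)
  next
    case 3
    have "ramp n s j + lval s l = lval s l + ramp n s j"
      using commute_lval[of s i "ramp n s j" i b] ramp_low[of i j] 3 i j l by simp
    moreover have "fval (loop n s) g + lval s l
        = lval s l + fval (loop n s) (app (wval sigma [flip l]) g)"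
      using conj_fval_loop_letter[of l g] 3 i j l by simp
    ultimately have "wval s (w @ [l]) = wval s (h @ [l])
        + fval (loop n s) (app (wval sigma [flip l]) g) + ramp n s j"
      using shift_past IH by simp
    then show ?thesis
      using 3 i h j l 
      unfolding comb by (auto simp: letters_def simp del: wval_simps)
  next
    case 4
    define m where "m = (i - 1, b)"
    have "ramp n s j + lval s l = lval s m + ramp n s j"
      using commute_lval[of s "i - 1" "ramp n s j" i b] ramp_high[of j "i - 1"] 4 i j l m_def
      by simp
    moreover have "fval (loop n s) g + lval s m
        = lval s m + fval (loop n s) (app (wval sigma [flip m]) g)"
      using conj_fval_loop_letter[of m g] 4 i j m_def by simp
    ultimately have "wval s (w @ [l]) = wval s (h @ [m])
        + fval (loop n s) (app (wval sigma [flip m]) g) + ramp n s j"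
      using shift_past IH by simp
    then show ?thesis
      using 4 i h j l m_def 
      unfolding comb by (auto simp: letters_def simp del: wval_simps)
  qed
qed

end

section \<open>Growth of powers of pure braids\<close>

definition kl :: "nat \<Rightarrow> nat \<Rightarrow> free" where
  "kl n j = (if 1 \<le> j \<and> j < n then gen j else 0)"

definition kill :: "nat \<Rightarrow> free \<Rightarrow> free" where
  "kill n = fval (kl n)"

lemma kill_simps [simp]: "kill n 0 = 0" "kill n (x + y) = kill n x + kill n y"
  "kill n (- x) = - kill n x" "kill n (gen j) = kl n j" "kill n (x - y) = kill n x - kill n y"
  by (simp_all add: kill_def)

lemma kill_nmul [simp]: "kill n (nmul k x) = nmul k (kill n x)"
  by (simp add: kill_def)

lemma len_kill: "len (kill n x) \<le> len x"
  using len_fval[of "kl n" 1 x] by (simp add: kill_def kl_def)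

lemma additive_ramp: "additive (app (ramp n sigma j))"
proof -
  have "ramp n sigma j = wval sigma (map (\<lambda>i. (i, True)) (rev [j..<n]))"
    by (simp add: ramp_def wval_def comp_def)
  then show ?thesis
    by (simp add: additive_rho)
qed

lemma additive_loop: "additive (app (loop n sigma j))"
  by (auto simp: loop_def diff_conv_add_uminus simp del: add_uminus_conv_diff
      intro!: additive_app_plus additive_app_uminus additive_ramp additive_sigma additive_app_zero)

text \<open>The ramp carries \<open>gen j\<close> to the killed \<open>gen n\<close>, and the
  conjugations that it introduces are by killed elements. What remains is to delete
  \<open>gen j\<close> and to renumber the generators above it.\<close>

lemma kill_ramp:
  assumes "1 \<le> j" "j \<le> n"
  shows "kill n (app (ramp n sigma j) x)
    = fval (\<lambda>i. if i < j then kl n i else if i = j then 0 else kl n (i - 1)) x"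
  using assms(2,1)
proof (induction j arbitrary: x rule: inc_induct)
  case base
  have "kl n = (\<lambda>i. if i < n then kl n i else if i = n then 0 else kl n (i - 1))"
    by (auto simp: kl_def fun_eq_iff)
  then show ?case
    by (simp add: kill_def)
next
  case (step j)
  have "kill n (app (ramp n sigma j) x) = kill n (app (ramp n sigma (Suc j)) (app (sigma j) x))"
    using step by (simp add: ramp_less[of j])
  also have "\<dots> = fval (\<lambda>i. if i < Suc j then kl n i else if i = Suc j then 0 else kl n (i - 1))
      (app (sigma j) x)"
    using step by simp
  also have "\<dots> = fval (\<lambda>i. if i < j then kl n i else if i = j then 0 else kl n (i - 1)) x"
    unfolding app_sigma fval_fval
    by (rule arg_cong[of _ _ "\<lambda>f. fval f x"]) (auto simp: fun_eq_iff)
  finally show ?case .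
qed

lemma loop_ramp:
  assumes "1 \<le> j" "j < n"
  shows "loop n s j + ramp n s (Suc j) = ramp n s j + s j"
  using assms by (simp add: loop_def ramp_less[of j] add.assoc)

text \<open>Once the last strand is forgotten, its loop around another strand disappears.\<close>

lemma kill_loop: "kill n (app (loop n sigma j) x) = kill n x"
proof (cases "1 \<le> j \<and> j < n")
  case True
  \<comment> \<open>With \<open>x\<close> written as the image of \<open>y\<close> under the ramp,
    the inverse ramp inside the loop cancels, and two applications of \<open>kill_ramp\<close> can
    be compared.\<close>
  define y where "y = app (- ramp n sigma (Suc j)) x"
  have x: "x = app (ramp n sigma (Suc j)) y"
    by (simp add: y_def)
  have "app (loop n sigma j) x = app (ramp n sigma j) (app (sigma j) y)"
    using True loop_ramp[of j n sigma] by (simp add: x flip: app_plus)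
  also have "kill n \<dots> = kill n x"
    using True
    by (simp add: x kill_ramp app_sigma fval_fval)
      (auto intro!: arg_cong[of _ _ "\<lambda>f. fval f y"] simp: fun_eq_iff)
  finally show ?thesis .
qed (auto simp: loop_def)

lemma kill_uminus_loop: "kill n (app (- loop n sigma j) x) = kill n x"
  using kill_loop[of n j "app (- loop n sigma j) x"] by simp

lemma kill_fval_loop: "kill n (app (fval (loop n sigma) g) x) = kill n x"
  by (induction g rule: free_induct) (simp_all add: kill_loop kill_uminus_loop)

lemma ramp_gen: "j \<le> n \<Longrightarrow> app (ramp n sigma j) (gen j) = gen n"
proof (induction j rule: inc_induct)
  case (step j)
  then show ?case
    by (simp add: ramp_less[of j] app_sigma)
qed simp

lemma loop_gen: "\<exists>u. app (loop n sigma j) (gen n) = - u + gen n + u \<and> kill n u = kl n j"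
proof (cases "1 \<le> j \<and> j < n")
  case True
  define c where "c = app (ramp n sigma (Suc j))"
  have add: "additive c"
    by (simp add: c_def additive_ramp)
  have c: "c (gen (Suc j)) = gen n"
    using True ramp_gen by (simp add: c_def)
  have "app (loop n sigma j) (gen n) = app (loop n sigma j + ramp n sigma (Suc j)) (gen (Suc j))"
    using c by (simp add: c_def)
  also have "\<dots> = c (app (sigma j) (app (sigma j) (gen (Suc j))))"
    using True by (simp only: loop_ramp) (simp add: ramp_less[of j] c_def)
  \<comment> \<open>The full twist on two strands conjugates by \<open>gen j + gen (Suc j)\<close>.
    The ramp then sends \<open>gen (Suc j)\<close> to the killed \<open>gen n\<close>, so only
    \<open>gen j\<close> survives in the conjugator.\<close>
  also have "app (sigma j) (app (sigma j) (gen (Suc j)))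
      = - (gen j + gen (Suc j)) + gen (Suc j) + (gen j + gen (Suc j))"
    by (simp add: app_sigma add.assoc minus_add diff_conv_add_uminus del: add_uminus_conv_diff)
  also have "c \<dots> = - c (gen j + gen (Suc j)) + gen n + c (gen j + gen (Suc j))"
    by (simp only: additiveD(1,3)[OF add] c)
  moreover have "kill n (c (gen j + gen (Suc j))) = kl n j"
    unfolding c_def using True by (subst kill_ramp) auto
  ultimately show ?thesis
    by metis
next
  case False
  then show ?thesis
    by (intro exI[of _ 0]) (auto simp: loop_def kl_def)
qed

text \<open>Conjugators compose like a crossed homomorphism: putting the loop \<open>i\<close> in
  front turns \<open>u\<close> into \<open>v + app (loop n sigma i) u\<close>. Since loops act
  trivially after killing \<open>gen n\<close>, this becomes a homomorphism there, and it recovers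
  \<open>kill n g\<close>.\<close>

lemma fval_loop_gen:
  "\<exists>u. app (fval (loop n sigma) g) (gen n) = - u + gen n + u \<and> kill n u = kill n g"
proof (induction g rule: free_induct)
  case zero
  show ?case
    by (rule exI[of _ 0]) simp
next
  case (plus i g)
  then obtain u where u: "app (fval (loop n sigma) g) (gen n) = - u + gen n + u" "kill n u = kill n g"
    by blast
  obtain v where v: "app (loop n sigma i) (gen n) = - v + gen n + v" "kill n v = kl n i"
    using loop_gen by blast
  show ?case
    by (rule exI[of _ "v + app (loop n sigma i) u"])
      (simp add: u v additiveD[OF additive_loop] kill_loop minus_add add.assoc
        diff_conv_add_uminus del: add_uminus_conv_diff)
next
  case (minus i g)
  let ?L = "app (- loop n sigma i)"
  have add: "additive ?L"
    by (intro additive_app_uminus additive_loop)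
  obtain u where u: "app (fval (loop n sigma) g) (gen n) = - u + gen n + u" "kill n u = kill n g"
    using minus by blast
  obtain v where v: "app (loop n sigma i) (gen n) = - v + gen n + v" "kill n v = kl n i"
    using loop_gen by blast
  have "?L (app (loop n sigma i) (gen n)) = - ?L v + ?L (gen n) + ?L v"
    by (simp only: v additiveD[OF add])
  then have "gen n = - ?L v + (?L (gen n) + ?L v)"
    by (simp add: add.assoc)
  \<comment> \<open>Conjugating back by \<open>?L v\<close> isolates the image of
    \<open>gen n\<close> under the inverse loop.\<close>
  then have "?L v + gen n + - ?L v = ?L v + (- ?L v + (?L (gen n) + ?L v)) + - ?L v"
    by (rule arg_cong)
  then have "?L (gen n) = ?L v + gen n + - ?L v"
    by (simp add: add.assoc diff_conv_add_uminus del: add_uminus_conv_diff)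
  then show ?case
    by (intro exI[of _ "- ?L v + ?L u"])
      (simp add: u v additiveD[OF add] kill_uminus_loop minus_add add.assoc
        diff_conv_add_uminus del: add_uminus_conv_diff)
qed

lemma fval_loop_kill: "fval (loop n s) (kill n g) = fval (loop n s) g"
  unfolding kill_def fval_fval
  by (rule arg_cong[of _ _ "\<lambda>f. fval f g"]) (auto simp: fun_eq_iff kl_def loop_def)

lemma kill_sigma:
  assumes "1 \<le> i" "Suc i < n"
  shows "kill n (app (sigma i) x) = app (sigma i) (kill n x)"
  by (rule additive_eqI[of "\<lambda>x. kill n (app (sigma i) x)" "\<lambda>x. app (sigma i) (kill n x)"])
    (use assms in \<open>auto simp: additive_def additiveD[OF additive_sigma]\<close>,
     auto simp: app_sigma kl_def)

lemma kill_rho: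
  assumes "w \<in> lists (letters {1..<n - 1})"
  shows "kill n (app (wval sigma w) x) = app (wval sigma w) (kill n x)"
  using assms
proof (induction w)
  case (Cons l w)
  obtain i b where l: "l = (i, b)"
    by fastforce
  have i: "1 \<le> i" "Suc i < n"
    using Cons l by (auto simp: letters_def)
  have "app (sigma i) (kill n (app (- sigma i) y)) = kill n y" for y
    using kill_sigma[OF i, of "app (- sigma i) y"] by simp
  then have "app (- sigma i) (app (sigma i) (kill n (app (- sigma i) y))) = app (- sigma i) (kill n y)"
    for y
    by simp
  then have "kill n (app (- sigma i) y) = app (- sigma i) (kill n y)" for y
    by simp
  then show ?case
    using Cons l i by (simp add: kill_sigma)
qed simp

lemma ramp_tau: "j \<le> n \<Longrightarrow> app (ramp n tau j) j = n"
proof (induction j rule: inc_induct)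
  case (step j)
  then show ?case
    by (simp add: ramp_less[of j] app_tau)
qed simp

lemma fval_loop_tau [simp]: "fval (loop n tau) g = 0"
proof -
  have "loop n tau j = 0" for j
    by (simp add: loop_def)
  then show ?thesis
    by (induction g rule: free_induct) simp_all
qed

lemma tau_fixes:
  assumes "w \<in> lists (letters {1..<n - 1})"
  shows "app (wval tau w) n = n"
  using assms by (induction w) (auto simp: letters_def app_tau split: if_splits)

text \<open>Growth is observed only in Artin's automorphisms, whereas triviality is obtained for an
  arbitrary family \<open>s\<close>; this carries information from the automorphisms back to the
  braid group. The clause \<open>wval sigma w = 0\<close> is there for the induction, where the
  smaller braid has to drop out of the action.\<close>

theorem pure_braid_dichotomy:
  assumes "braid_family n s" "w \<in> lists (letters {1..<n})" "wval tau w = 0"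
  shows "wval s w = 0 \<and> wval sigma w = 0
    \<or> (\<forall>k. \<exists>i\<in>{1..n}. k \<le> len (app (nmul k (wval sigma w)) (gen i)))"
  using assms
proof (induction n arbitrary: w)
  case 0
  then have "w = []"
    by (cases w) (auto simp: letters_def)
  then show ?case
    by simp
next
  case (Suc m)
  let ?n = "Suc m"
  obtain h g j where comb: "comb ?n w = (h, g, j)"
    by (cases "comb ?n w")
  \<comment> \<open>The family \<open>t\<close> may live in any type, so the same triple is
    available for \<open>tau\<close>, \<open>sigma\<close> and \<open>s\<close>.\<close>
  have comb_eq: "wval t w = wval t h + fval (loop ?n t) g + ramp ?n t j
      \<and> h \<in> lists (letters {1..<m}) \<and> 1 \<le> j \<and> j \<le> ?n" if "braid_family ?n t"
      for t :: "nat \<Rightarrow> 'x::group_add"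
    using braid_family.comb_correct[OF that _ Suc(3)] comb by simp
  have h: "h \<in> lists (letters {1..<m})" and j: "1 \<le> j" "j \<le> ?n"
    using comb_eq[OF braid_family_tau] by auto
  \<comment> \<open>The ramp takes \<open>j\<close> to the last point, and both the loops and
    \<open>h\<close> fix that point. As \<open>w\<close> is pure, \<open>j\<close> must be the last
    point itself.\<close>
  have "app (wval tau h) ?n = j"
    using comb_eq[OF braid_family_tau] Suc(4) ramp_tau[OF j(2)]
    by (metis app_plus app_zero fval_loop_tau add_0_right)
  then have jn: "j = ?n"
    using tau_fixes[of h ?n] h by simp
  have tau_h: "wval tau h = 0"
    using comb_eq[OF braid_family_tau] Suc(4) jn by simp
  have rho: "wval sigma w = wval sigma h + fval (loop ?n sigma) g"
    using comb_eq[OF braid_family_sigma] jn by simp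
  have "braid_family m s"
    using Suc(2) by (auto simp: braid_family_def)
  from Suc(1)[OF this h tau_h] show ?case
  proof
    assume triv: "wval s h = 0 \<and> wval sigma h = 0"
    show ?thesis
    \<comment> \<open>If this element is trivial, the loop word vanishes in every family. Otherwise
      its powers grow in length, and they appear in the conjugators of
      \<open>gen ?n\<close>.\<close>
    proof (cases "kill ?n g = 0")
      case True
      have "fval (loop ?n t) g = 0" for t :: "nat \<Rightarrow> 'x::group_add"
        using fval_loop_kill[of ?n t g] True by simp
      then show ?thesis
        using comb_eq[OF Suc(2)] fval_loop_kill[of ?n s g] fval_loop_kill[of ?n sigma g]
          True jn triv rho by simp
    next
      case False
      have "k \<le> len (app (nmul k (wval sigma w)) (gen ?n))" for k
      proof -
        have "nmul k (wval sigma w) = fval (loop ?n sigma) (nmul k g)"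
          using rho triv by simp
        then obtain u where u: "app (nmul k (wval sigma w)) (gen ?n) = - u + gen ?n + u"
          "kill ?n u = nmul k (kill ?n g)"
          using fval_loop_gen[of ?n "nmul k g"] by auto
        have "k \<le> len (kill ?n u)"
          using u(2) len_nmul[OF False] by simp
        also have "\<dots> \<le> len (- u + gen ?n + u)"
          unfolding kill_def by (rule len_conj_gen) (auto simp: kl_def)
        finally show ?thesis
          using u(1) by simp
      qed
      then show ?thesis
        by (intro disjI2 allI bexI[of _ ?n]) auto
    qed
  next
    assume growth: "\<forall>k. \<exists>i\<in>{1..m}. k \<le> len (app (nmul k (wval sigma h)) (gen i))"
    \<comment> \<open>Forgetting the last strand turns \<open>w\<close> into \<open>h\<close> and
      does not increase lengths, so \<open>w\<close> inherits the growth of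
      \<open>h\<close>.\<close>
    have kill: "kill ?n (app (nmul k (wval sigma w)) x) = app (nmul k (wval sigma h)) (kill ?n x)"
      for k x
      by (induction k arbitrary: x)
        (use h in \<open>simp_all add: nmul_Suc rho kill_rho kill_fval_loop\<close>)
    have "\<exists>i\<in>{1..?n}. k \<le> len (app (nmul k (wval sigma w)) (gen i))" for k
    proof -
      obtain i where i: "i \<in> {1..m}" "k \<le> len (app (nmul k (wval sigma h)) (gen i))"
        using growth by blast
      have "app (nmul k (wval sigma h)) (gen i) = kill ?n (app (nmul k (wval sigma w)) (gen i))"
        using i(1) kill[of k "gen i"] by (simp add: kl_def)
      then have "k \<le> len (app (nmul k (wval sigma w)) (gen i))"
        using i(2) len_kill le_trans by metis
      then show ?thesis
        using i(1) by force
    qed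
    then show ?thesis
      by blast
  qed
qed

section \<open>The word problem and bounded powers in braid groups\<close>

abbreviation braid_words :: "nat \<Rightarrow> nat word set" where
  "braid_words n \<equiv> lists (letters (braid_gens n))"

abbreviation braid_eq :: "nat \<Rightarrow> nat word \<Rightarrow> nat word \<Rightarrow> bool" where
  "braid_eq n \<equiv> pres_eq (braid_gens n) (braid_relations n)"

lemma wval_braid_eq:
  assumes "braid_family n s" "braid_eq n u v"
  shows "wval s u = wval s v"
proof (rule wval_pres_eq[OF assms(2)])
  fix u v :: "nat word"
  assume "(u, v) \<in> braid_relations n"
  then consider (far) i j where "u = [(i, True), (j, True)]" "v = [(j, True), (i, True)]"
      "i \<in> braid_gens n" "j \<in> braid_gens n" "\<bar>int i - int j\<bar> \<ge> 2"
    | (braid) i where "u = [(i, True), (i + 1, True), (i, True)]"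
      "v = [(i + 1, True), (i, True), (i + 1, True)]" "i \<in> braid_gens n" "i + 1 \<in> braid_gens n"
    unfolding braid_relations_def by blast
  then show "wval s u = wval s v"
  proof cases
    case far
    then have "i + 2 \<le> j \<or> j + 2 \<le> i"
      by linarith
    then show ?thesis
      using far braid_family.far[OF assms(1), of i j] braid_family.far[OF assms(1), of j i]
      by (auto simp: braid_gens_def)
  next
    case braid
    then show ?thesis
      using braid_family.braid[OF assms(1), of i] by (simp add: braid_gens_def add.assoc)
  qed
qed

lemma braid_carrier: "carrier (braid_group n) = braid_of_word n ` braid_words n"
  by (simp add: braid_group_def presented_group_def braid_of_word_def)

lemma braid_one: "\<one>\<^bsub>braid_group n\<^esub> = braid_of_word n []"
  by (simp add: braid_group_def presented_group_def braid_of_word_def)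

lemma braid_mult:
  "u \<in> braid_words n \<Longrightarrow> v \<in> braid_words n \<Longrightarrow>
    braid_of_word n u \<otimes>\<^bsub>braid_group n\<^esub> braid_of_word n v = braid_of_word n (u @ v)"
  unfolding braid_group_def braid_of_word_def by (rule presented_group_mult)

lemma braid_of_word_eq_iff:
  "u \<in> braid_words n \<Longrightarrow> braid_of_word n u = braid_of_word n v \<longleftrightarrow> braid_eq n u v"
  unfolding braid_of_word_def by (rule pres_class_eq_iff)

text \<open>Braid families live in a type of class \<^class>\<open>group_add\<close>, whereas the braid group is a set that
  depends on \<open>n\<close>. The results are transferred by the left regular action of the braid group, extended
  by the identity to all sets of words.\<close>

definition lmul :: "nat \<Rightarrow> letter \<Rightarrow> nat word set \<Rightarrow> nat word set" where
  "lmul n l A = (if A \<in> carrier (braid_group n) then braid_of_word n [l] \<otimes>\<^bsub>braid_group n\<^esub> A else A)"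

definition cayley :: "nat \<Rightarrow> nat \<Rightarrow> nat word set symm" where
  "cayley n i = Symm (lmul n (i, True))"

lemma lmul_outside: "A \<notin> carrier (braid_group n) \<Longrightarrow> lmul n l A = A"
  by (simp add: lmul_def)

lemma lmul_braid_of_word:
  assumes "fst l \<in> braid_gens n" "w \<in> braid_words n"
  shows "lmul n l (braid_of_word n w) = braid_of_word n (l # w)"
proof -
  have "[l] \<in> braid_words n"
    using assms(1) by (cases l) (simp add: letters_def)
  then show ?thesis
    using assms(2) braid_mult[of "[l]" n w] by (simp add: lmul_def braid_carrier)
qed

lemma lmul_flip:
  assumes "fst l \<in> braid_gens n"
  shows "lmul n l (lmul n (flip l) A) = A"
proof (cases "A \<in> carrier (braid_group n)")
  case True
  then obtain w where w: "A = braid_of_word n w" "w \<in> braid_words n"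
    by (auto simp: braid_carrier)
  obtain i b where l: "l = (i, b)"
    by fastforce
  have l': "l # flip l # w \<in> braid_words n" "flip l # w \<in> braid_words n"
    using assms w l by (auto simp: letters_def)
  have "braid_eq n ([(i, b), (i, \<not> b)] @ w) ([] @ w)"
    by (rule pres_eq_append) (use assms w l in \<open>auto intro: pres_eq.intros\<close>)
  then have "braid_of_word n (l # flip l # w) = braid_of_word n w"
    using l l' by (subst braid_of_word_eq_iff) auto
  then show ?thesis
    using w assms l' by (simp add: lmul_braid_of_word)
qed (simp add: lmul_outside)

lemma app_cayley:
  assumes "i \<in> braid_gens n"
  shows "app (cayley n i) = lmul n (i, True)" "app (- cayley n i) = lmul n (i, False)"
proof -
  show 1: "app (cayley n i) = lmul n (i, True)"
    unfolding cayley_def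
    by (rule app_Symm[where g = "lmul n (i, False)"])
      (use assms lmul_flip[of "(i, True)"] lmul_flip[of "(i, False)"] in auto)
  have "app (- cayley n i) (lmul n (i, True) (lmul n (i, False) A)) = lmul n (i, False) A" for A
    unfolding 1[symmetric] by simp
  then show "app (- cayley n i) = lmul n (i, False)"
    using assms lmul_flip[of "(i, True)" n] by auto
qed

lemma app_wval_cayley:
  assumes "u \<in> braid_words n" "w \<in> braid_words n"
  shows "app (wval (cayley n) u) (braid_of_word n w) = braid_of_word n (u @ w)"
  using assms(1)
proof (induction u)
  case (Cons l u)
  have "fst l \<in> braid_gens n" "u @ w \<in> braid_words n"
    using Cons assms(2) by (auto simp: letters_def)
  then show ?case
    using Cons by (cases l) (auto simp: app_cayley lmul_braid_of_word)
qed simp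

lemma app_wval_cayley_outside:
  assumes "u \<in> braid_words n" "A \<notin> carrier (braid_group n)"
  shows "app (wval (cayley n) u) A = A"
  using assms(1)
proof (induction u)
  case (Cons l u)
  have "fst l \<in> braid_gens n"
    using Cons by (auto simp: letters_def)
  then show ?case
    using Cons by (cases l; cases "snd l") (auto simp: app_cayley lmul_outside[OF assms(2)])
qed simp

text \<open>The regular action is faithful: evaluation at the class of the empty word recovers the
  braid.\<close>

lemma wval_cayley_eq_iff:
  assumes "u \<in> braid_words n" "v \<in> braid_words n"
  shows "wval (cayley n) u = wval (cayley n) v \<longleftrightarrow> braid_eq n u v"
proof
  assume "wval (cayley n) u = wval (cayley n) v"
  then have "braid_of_word n (u @ []) = braid_of_word n (v @ [])"
    using app_wval_cayley[of u n "[]"] app_wval_cayley[of v n "[]"] assms by simp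
  then show "braid_eq n u v"
    using assms by (simp add: braid_of_word_eq_iff)
next
  assume eq: "braid_eq n u v"
  show "wval (cayley n) u = wval (cayley n) v"
  proof (rule symm_eqI)
    fix A
    show "app (wval (cayley n) u) A = app (wval (cayley n) v) A"
    proof (cases "A \<in> carrier (braid_group n)")
      case True
      then obtain w where w: "A = braid_of_word n w" "w \<in> braid_words n"
        by (auto simp: braid_carrier)
      have "braid_eq n (u @ w) (v @ w)"
        using eq w by (auto intro: pres_eq_append pres_eq.refl)
      then show ?thesis
        using assms w by (simp add: app_wval_cayley braid_of_word_eq_iff)
    qed (simp add: app_wval_cayley_outside assms)
  qed
qed

lemma braid_family_cayley: "braid_family n (cayley n)"
proof
  fix i j :: nat
  assume ij: "1 \<le> i" "i + 2 \<le> j" "j < n"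
  have "braid_eq n [(i, True), (j, True)] [(j, True), (i, True)]"
    using ij by (intro pres_eq.relator) (auto simp: braid_relations_def braid_gens_def letters_def)
  then show "cayley n i + cayley n j = cayley n j + cayley n i"
    using wval_cayley_eq_iff[of "[(i, True), (j, True)]" n "[(j, True), (i, True)]"] pres_eq_words
    by fastforce
next
  fix i :: nat
  assume i: "1 \<le> i" "Suc i < n"
  have "braid_eq n [(i, True), (i + 1, True), (i, True)] [(i + 1, True), (i, True), (i + 1, True)]"
    using i by (intro pres_eq.relator) (auto simp: braid_relations_def braid_gens_def letters_def)
  then show "cayley n i + cayley n (Suc i) + cayley n i
      = cayley n (Suc i) + cayley n i + cayley n (Suc i)"
    using wval_cayley_eq_iff[of "[(i, True), (i + 1, True), (i, True)]" n
        "[(i + 1, True), (i, True), (i + 1, True)]"] pres_eq_words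
    by (fastforce simp: add.assoc)
qed

lemma tau_outside:
  assumes "w \<in> braid_words n" "j \<notin> {1..n}"
  shows "app (wval tau w) j = j"
  using assms by (induction w) (auto simp: letters_def braid_gens_def app_tau split: if_splits)

section \<open>Faithfulness of Artin's action\<close>

definition exponent :: "nat \<Rightarrow> free \<Rightarrow> int" where
  "exponent j = fval (\<lambda>i. if i = j then 1 else 0)"

text \<open>On the abelianised free group Artin's automorphisms permute the coordinates as
  \<open>tau\<close> does, so the permutation of a braid can be read off its action.\<close>

lemma exponent_sigma: "exponent (app (tau i) j) (app (sigma i) x) = exponent j x"
  unfolding exponent_def app_sigma fval_fval
  by (rule arg_cong[of _ _ "\<lambda>f. fval f x"]) (auto simp: fun_eq_iff app_tau)

lemma exponent_rho: "exponent (app (wval tau w) j) (app (wval sigma w) x) = exponent j x"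
proof (induction w)
  case (Cons l w)
  have "exponent (app (tau i) k) (app (- sigma i) y) = exponent k y" for i k y
    using exponent_sigma[of i "app (tau i) k" "app (- sigma i) y"]
      app_uminus_app(1)[of "tau i" k] by simp
  then show ?case
    using Cons by (cases l) (simp add: exponent_sigma)
qed simp

definition acts_trivially :: "nat \<Rightarrow> nat word \<Rightarrow> bool" where
  "acts_trivially n w \<longleftrightarrow> (\<forall>i\<in>{1..n}. app (wval sigma w) (gen i) = gen i)"

theorem braid_word_problem:
  assumes "w \<in> braid_words n"
  shows "braid_eq n w [] \<longleftrightarrow> acts_trivially n w"
proof
  assume "braid_eq n w []"
  then show "acts_trivially n w"
    using wval_braid_eq[OF braid_family_sigma] by (simp add: acts_trivially_def)
next
  assume triv: "acts_trivially n w"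
  have "app (wval tau w) j = j" for j
  proof (cases "j \<in> {1..n}")
    case True
    then show ?thesis
      using exponent_rho[of w j "gen j"] triv
      by (simp add: acts_trivially_def exponent_def split: if_splits)
  qed (use tau_outside assms in blast)
  then have tau: "wval tau w = 0"
    by (intro symm_eqI) simp
  \<comment> \<open>Fixed generators keep length 1, so the growth alternative already fails for
    \<open>k = 2\<close>.\<close>
  have "\<not> (\<exists>i\<in>{1..n}. 2 \<le> len (app (nmul 2 (wval sigma w)) (gen i)))"
    using triv by (simp add: acts_trivially_def numeral_2_eq_2 nmul_Suc)
  then have "wval (cayley n) w = 0"
    using pure_braid_dichotomy[OF braid_family_cayley _ tau, of n] assms
    unfolding braid_gens_def by blast
  then show "braid_eq n w []"
    using wval_cayley_eq_iff[OF assms, of "[]"] by simp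
qed

section \<open>A bound for the exponent\<close>

lemma nmul_diff_eq_0:
  fixes g :: "'g::group_add"
  assumes "nmul i g = nmul j g" "i < j"
  shows "nmul (j - i) g = 0"
proof -
  have "nmul i g + nmul (j - i) g = nmul i g + 0"
    using nmul_add[of i "j - i" g] assms by simp
  then show ?thesis
    by (rule add_left_imp_eq)
qed

text \<open>Each permutation of \<open>{1..n}\<close> has a finite order by the pigeonhole
  principle, and the product of one such exponent per permutation serves all braids.\<close>

lemma permutation_exponent:
  "\<exists>M>0. \<forall>w\<in>braid_words n. nmul M (wval tau w) = 0"
proof -
  define P :: "nat symm set" where "P = {p. \<forall>x. x \<notin> {1..n} \<longrightarrow> app p x = x}"
  have "app p permutes {1..n}" if "p \<in> P" for p
    using that app[of p] unfolding P_def permutes_def mem_Collect_eq bij_iff by blast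
  then have "app ` P \<subseteq> {f. f permutes {1..n}}"
    by blast
  then have "finite (app ` P)"
    by (rule finite_subset) (simp add: finite_permutations)
  then have fin: "finite P"
    by (rule finite_imageD) (simp add: inj_on_def app_inject)
  have "\<exists>k>0. nmul k p = 0" if "p \<in> P" for p
  proof -
    have "nmul k p \<in> P" for k
      using that by (induction k) (simp_all add: P_def nmul_Suc)
    then have "range (\<lambda>k. nmul k p) \<subseteq> P"
      by blast
    then have "\<not> inj (\<lambda>k. nmul k p)"
      using fin finite_subset finite_imageD infinite_UNIV_nat by metis
    then obtain i j where "nmul i p = nmul j p" "i < j"
      unfolding inj_def by (metis linorder_neqE_nat)
    then show ?thesis
      using nmul_diff_eq_0 by (metis zero_less_diff)
  qed
  then obtain e where e: "\<And>p. p \<in> P \<Longrightarrow> 0 < e p \<and> nmul (e p) p = 0"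
    by metis
  have "nmul (prod e P) (wval tau w) = 0" if "w \<in> braid_words n" for w
  proof -
    have p: "wval tau w \<in> P"
      using that tau_outside by (simp add: P_def)
    then have "prod e P = prod e (P - {wval tau w}) * e (wval tau w)"
      using fin by (simp add: prod.remove)
    then show ?thesis
      using e[OF p] by (simp add: nmul_mult)
  qed
  moreover have "0 < prod e P"
    using e by (simp add: prod_pos)
  ultimately show ?thesis
    by blast
qed

text \<open>Each letter replaces a generator by at most three.\<close>

lemma len_rho: "len (app (wval sigma w) x) \<le> 3 ^ length w * len x"
proof (induction w)
  case (Cons l w)
  have three: "len (a + b + c) \<le> len a + len b + len c" for a b c
    using len_add[of "a + b" c] len_add[of a b] by linarith
  have "len (app (lval sigma l) y) \<le> 3 * len y" for y
    using three[of "- gen (Suc (fst l))" "gen (fst l)" "gen (Suc (fst l))"]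
      three[of "gen (fst l)" "gen (Suc (fst l))" "- gen (fst l)"]
      len_uminus[of "gen (fst l)"] len_uminus[of "gen (Suc (fst l))"]
    by (cases l) (auto simp: app_sigma app_uminus_sigma intro!: len_fval)
  then have "len (app (lval sigma l) (app (wval sigma w) x)) \<le> 3 * len (app (wval sigma w) x)" .
  with Cons show ?case
    by simp
qed simp

lemma concat_replicate_in_lists [simp]: "w \<in> lists A \<Longrightarrow> concat (replicate k w) \<in> lists A"
  by (induction k) auto

text \<open>Let \<open>X\<close> be the pure braid \<open>x^M\<close>. If \<open>x^k = y\<close>,
  then \<open>X^k = y^M\<close>, and growth bounds \<open>k\<close> by the length of an image under
  \<open>y^M\<close>. If \<open>X\<close> is trivial instead, \<open>k\<close> can be reduced modulo
  \<open>M\<close>.\<close>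

theorem braid_power_bound:
  "\<exists>C. \<forall>x y k. x \<in> braid_words n \<longrightarrow> y \<in> braid_words n \<longrightarrow> braid_eq n (concat (replicate k x)) y \<longrightarrow>
    (\<exists>k'\<le>C ^ Suc (length y). braid_eq n (concat (replicate k' x)) y)"
proof -
  obtain M where M: "M > 0" "\<And>w. w \<in> braid_words n \<Longrightarrow> nmul M (wval tau w) = 0"
    using permutation_exponent[of n] by auto
  \<comment> \<open>The summand \<open>M\<close> covers the remainders modulo \<open>M\<close>, and
    \<open>3 ^ M\<close> is the factor that each letter of \<open>y\<close> contributes to the
    length under \<open>y^M\<close>. The exponent \<open>Suc (length y)\<close> keeps the bound at
    least \<open>C\<close> when \<open>y\<close> is empty.\<close>
  define C where "C = M + 3 ^ M"
  have C1: "C \<ge> 1"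
    using M(1) by (simp add: C_def)
  have "\<exists>k'\<le>C ^ Suc (length y). braid_eq n (concat (replicate k' x)) y"
    if x: "x \<in> braid_words n" and y: "y \<in> braid_words n"
      and eq: "braid_eq n (concat (replicate k x)) y" for x y k
  proof -
    let ?X = "concat (replicate M x)"
    have "wval tau ?X = 0"
      using M(2)[OF x] by simp
    moreover have "?X \<in> lists (letters {1..<n})"
      using x by (simp add: braid_gens_def)
    ultimately have "wval (cayley n) ?X = 0
        \<or> (\<forall>k. \<exists>i\<in>{1..n}. k \<le> len (app (nmul k (wval sigma ?X)) (gen i)))"
      using pure_braid_dichotomy[OF braid_family_cayley] by blast
    then show ?thesis
    proof
      assume 0: "wval (cayley n) ?X = 0"
      have "nmul k (wval (cayley n) x) = nmul (k mod M) (wval (cayley n) x)"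
        using 0 nmul_add[of "k div M * M" "k mod M" "wval (cayley n) x"]
        by (simp add: nmul_mult)
      then have "braid_eq n (concat (replicate (k mod M) x)) y"
        using eq x y by (simp flip: wval_cayley_eq_iff)
      moreover have "k mod M \<le> C ^ Suc (length y)"
      proof -
        have "k mod M \<le> C"
          using mod_less_divisor[OF M(1), of k] by (simp add: C_def)
        also have "\<dots> \<le> C ^ Suc (length y)"
          using C1 by simp
        finally show ?thesis .
      qed
      ultimately show ?thesis
        by blast
    next
      assume growth: "\<forall>k. \<exists>i\<in>{1..n}. k \<le> len (app (nmul k (wval sigma ?X)) (gen i))"
      have "nmul k (wval sigma x) = wval sigma y"
        using wval_braid_eq[OF braid_family_sigma eq] by simp
      then have "nmul k (wval sigma ?X) = wval sigma (concat (replicate M y))"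
        by (simp flip: nmul_mult) (simp add: mult.commute[of k] nmul_mult)
      then obtain i where "k \<le> len (app (wval sigma (concat (replicate M y))) (gen i))"
        using growth by metis
      also have "\<dots> \<le> 3 ^ length (concat (replicate M y))"
        using len_rho[of "concat (replicate M y)" "gen i"] by (simp del: wval_replicate)
      also have "length (concat (replicate M y)) = M * length y"
        by (induction M) simp_all
      also have "(3 :: nat) ^ (M * length y) = (3 ^ M) ^ length y"
        by (simp add: power_mult)
      also have "\<dots> \<le> C ^ length y"
        by (rule power_mono) (simp_all add: C_def)
      also have "\<dots> \<le> C ^ Suc (length y)"
        using C1 by simp
      finally show ?thesis
        using eq by blast
    qed
  qed
  then show ?thesis
    by blast
qed

section \<open>Powers and inverses of braids as words\<close>

lemma braid_pow:
  assumes "x \<in> braid_words n"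
  shows "braid_of_word n x [^]\<^bsub>braid_group n\<^esub> (k :: nat) = braid_of_word n (concat (replicate k x))"
proof (induction k)
  case 0
  then show ?case
    by (simp add: braid_one)
next
  case (Suc k)
  have "concat (replicate (Suc k) x) = concat (replicate k x) @ x"
    by (induction k) simp_all
  then show ?case
    using Suc assms by (simp add: braid_mult)
qed

lemma group_braid_group: "Group.group (braid_group n)"
  unfolding braid_group_def by (rule group_presented_group)

lemma braid_inv:
  assumes "x \<in> braid_words n"
  shows "inv\<^bsub>braid_group n\<^esub> braid_of_word n x = braid_of_word n (winv x)"
proof -
  interpret Group.group "braid_group n"
    by (rule group_braid_group)
  have "braid_of_word n (winv x) \<otimes>\<^bsub>braid_group n\<^esub> braid_of_word n x = \<one>\<^bsub>braid_group n\<^esub>"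
    using assms pres_eq_winv[OF assms, of "braid_relations n"]
    by (simp add: braid_mult braid_one braid_of_word_eq_iff)
  then show ?thesis
    using assms by (intro inv_equality) (auto simp: braid_carrier)
qed

theorem nonneg_power_orbit_bounded:
  "\<exists>C. \<forall>x\<in>braid_words n. \<forall>y\<in>braid_words n.
    in_nonneg_power_orbit (braid_group n) (braid_of_word n x) (braid_of_word n y) \<longleftrightarrow>
    (\<exists>k\<le>C ^ Suc (length y). acts_trivially n (y @ concat (replicate k (winv x))))"
proof -
  obtain C where C: "\<And>x y k. x \<in> braid_words n \<Longrightarrow> y \<in> braid_words n \<Longrightarrow>
      braid_eq n (concat (replicate k x)) y \<Longrightarrow>
      \<exists>k'\<le>C ^ Suc (length y). braid_eq n (concat (replicate k' x)) y"
    using braid_power_bound by meson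
  have nmul_uminus: "nmul k (- g) = - nmul k g" for k and g :: "'g::group_add"
  proof (induction k)
    case (Suc k)
    have "nmul (Suc k) g = nmul k g + g"
      using nmul_add[of k 1 g] by simp
    then show ?case
      using Suc by (simp add: nmul_Suc[of k "- g"] minus_add)
  qed simp
  have orbit: "in_nonneg_power_orbit (braid_group n) (braid_of_word n x) (braid_of_word n y) \<longleftrightarrow>
    (\<exists>k\<le>C ^ Suc (length y). acts_trivially n (y @ concat (replicate k (winv x))))"
    if x: "x \<in> braid_words n" and y: "y \<in> braid_words n" for x y
  proof -
    have eq: "braid_eq n (concat (replicate k x)) y
        \<longleftrightarrow> acts_trivially n (y @ concat (replicate k (winv x)))" for k
    proof -
      have w: "y @ concat (replicate k (winv x)) \<in> braid_words n"
        using x y by simp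
      have "braid_eq n (concat (replicate k x)) y
          \<longleftrightarrow> nmul k (wval (cayley n) x) = wval (cayley n) y"
        using x y by (simp flip: wval_cayley_eq_iff)
      also have "\<dots> \<longleftrightarrow> wval (cayley n) y - nmul k (wval (cayley n) x) = 0"
        by auto
      also have "\<dots> \<longleftrightarrow> braid_eq n (y @ concat (replicate k (winv x))) []"
        using wval_cayley_eq_iff[OF w, of "[]"] by (simp add: nmul_uminus)
      also have "\<dots> \<longleftrightarrow> acts_trivially n (y @ concat (replicate k (winv x)))"
        by (rule braid_word_problem[OF w])
      finally show ?thesis .
    qed
    have "in_nonneg_power_orbit (braid_group n) (braid_of_word n x) (braid_of_word n y) \<longleftrightarrow>
        (\<exists>k. braid_eq n (concat (replicate k x)) y)"
      using x by (simp add: in_nonneg_power_orbit_def braid_pow braid_of_word_eq_iff)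
    also have "\<dots> \<longleftrightarrow> (\<exists>k\<le>C ^ Suc (length y). braid_eq n (concat (replicate k x)) y)"
      using C[OF x y] by blast
    finally show ?thesis
      by (simp only: eq)
  qed
  then show ?thesis
    by blast
qed

lemma in_power_orbit_iff:
  assumes "x \<in> braid_words n" "y \<in> braid_words n"
  shows "in_power_orbit (braid_group n) (braid_of_word n x) (braid_of_word n y) \<longleftrightarrow>
    in_nonneg_power_orbit (braid_group n) (braid_of_word n x) (braid_of_word n y) \<or>
    in_nonneg_power_orbit (braid_group n) (braid_of_word n (winv x)) (braid_of_word n y)"
proof -
  interpret Group.group "braid_group n"
    by (rule group_braid_group)
  let ?x = "braid_of_word n x"
  have car: "?x \<in> carrier (braid_group n)"
    using assms by (simp add: braid_carrier)
  have "(\<exists>k :: int. ?x [^]\<^bsub>braid_group n\<^esub> k = y) \<longleftrightarrow>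
    (\<exists>k :: nat. ?x [^]\<^bsub>braid_group n\<^esub> k = y) \<or>
    (\<exists>k :: nat. (inv\<^bsub>braid_group n\<^esub> ?x) [^]\<^bsub>braid_group n\<^esub> k = y)" for y
  proof
    assume "\<exists>k :: int. ?x [^]\<^bsub>braid_group n\<^esub> k = y"
    then obtain k :: int where "?x [^]\<^bsub>braid_group n\<^esub> k = y"
      by blast
    then show "(\<exists>k :: nat. ?x [^]\<^bsub>braid_group n\<^esub> k = y) \<or>
      (\<exists>k :: nat. (inv\<^bsub>braid_group n\<^esub> ?x) [^]\<^bsub>braid_group n\<^esub> k = y)"
      using car by (cases k rule: int_cases2) (auto simp: int_pow_int int_pow_neg_int nat_pow_inv)
  next
    assume "(\<exists>k :: nat. ?x [^]\<^bsub>braid_group n\<^esub> k = y) \<or>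
      (\<exists>k :: nat. (inv\<^bsub>braid_group n\<^esub> ?x) [^]\<^bsub>braid_group n\<^esub> k = y)"
    then show "\<exists>k :: int. ?x [^]\<^bsub>braid_group n\<^esub> k = y"
      using car by (metis int_pow_int int_pow_neg_int nat_pow_inv)
  qed
  then show ?thesis
    using assms by (simp add: in_power_orbit_def in_nonneg_power_orbit_def braid_inv)
qed

section \<open>A structured language for Turing machines\<close>

datatype 'a com =
    Skip
  | Act nat "'a tape_symbol \<Rightarrow> 'a tape_symbol" head_move
  | Seq "'a com" "'a com"
  | Case nat "'a tape_symbol \<Rightarrow> 'a com"
  | While nat "'a tape_symbol \<Rightarrow> bool" "'a com"
  | Halt bool

text \<open>A list of commands is a stack of pending work, and these stacks become the machine
  states. \<open>Halt\<close> discards the pending work, so there is a single accepting and a single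
  rejecting state.\<close>

fun next_com :: "'a com list \<Rightarrow> (nat \<Rightarrow> 'a tape_symbol) \<Rightarrow> 'a com list" where
  "next_com [] r = []"
| "next_com (Skip # K) r = K"
| "next_com (Act i f m # K) r = K"
| "next_com (Seq a b # K) r = a # b # K"
| "next_com (Case i f # K) r = f (r i) # K"
| "next_com (While i P c # K) r = (if P (r i) then c # While i P c # K else K)"
| "next_com (Halt b # K) r = [Halt b]"

fun action :: "'a com list \<Rightarrow> (nat \<Rightarrow> 'a tape_symbol) \<Rightarrow> nat \<Rightarrow> 'a tape_symbol \<times> head_move" where
  "action (Act j f m # K) r i = (if i = j then (f (r i), m) else (r i, Stay))"
| "action K r i = (r i, Stay)"

definition cstep :: "'a com list \<times> (nat \<Rightarrow> 'a tape) \<Rightarrow> 'a com list \<times> (nat \<Rightarrow> 'a tape)" where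
  "cstep = (\<lambda>(K, tp). let r = (\<lambda>i. read_tape (tp i)) in
     (next_com K r, \<lambda>i. write_tape (tp i) (action K r i)))"

lemma write_read_Stay [simp]: "write_tape t (read_tape t, Stay) = t"
  by (cases t) simp

lemma cstep_simps [simp]:
  "cstep (Skip # K, tp) = (K, tp)"
  "cstep (Act i f m # K, tp) = (K, tp(i := write_tape (tp i) (f (read_tape (tp i)), m)))"
  "cstep (Seq a b # K, tp) = (a # b # K, tp)"
  "cstep (Case i g # K, tp) = (g (read_tape (tp i)) # K, tp)"
  "cstep (While i P c # K, tp) = (if P (read_tape (tp i)) then c # While i P c # K else K, tp)"
  "cstep (Halt v # K, tp) = ([Halt v], tp)"
  by (auto simp: cstep_def Let_def fun_eq_iff)

subsection \<open>Compilation to Turing machines\<close>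

text \<open>The stacks that arise while \<open>c\<close> runs on top of \<open>K\<close>, before
  \<open>K\<close> is exposed. A loop body runs on the same stack \<open>While i P c # K\<close> in
  every round, which keeps the set finite.\<close>

primrec reach :: "'a tape_symbol set \<Rightarrow> 'a com \<Rightarrow> 'a com list \<Rightarrow> 'a com list set" where
  "reach A Skip K = {Skip # K}"
| "reach A (Act i f m) K = {Act i f m # K}"
| "reach A (Seq a b) K = insert (Seq a b # K) (reach A a (b # K) \<union> reach A b K)"
| "reach A (Case i f) K = insert (Case i f # K) (\<Union>x\<in>A. reach A (f x) K)"
| "reach A (While i P c) K = insert (While i P c # K) (reach A c (While i P c # K))"
| "reach A (Halt b) K = {Halt b # K}"

primrec wf_com :: "nat \<Rightarrow> 'a tape_symbol set \<Rightarrow> 'a com \<Rightarrow> bool" where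
  "wf_com k A Skip \<longleftrightarrow> True"
| "wf_com k A (Act i f m) \<longleftrightarrow> i < k \<and> f ` A \<subseteq> A"
| "wf_com k A (Seq a b) \<longleftrightarrow> wf_com k A a \<and> wf_com k A b"
| "wf_com k A (Case i f) \<longleftrightarrow> i < k \<and> (\<forall>x\<in>A. wf_com k A (f x))"
| "wf_com k A (While i P c) \<longleftrightarrow> i < k \<and> wf_com k A c"
| "wf_com k A (Halt b) \<longleftrightarrow> True"

lemma finite_reach: "finite A \<Longrightarrow> finite (reach A c K)"
  by (induction c arbitrary: K) auto

lemma Cons_in_reach: "c # K \<in> reach A c K"
  by (cases c) auto

lemma next_com_in_reach:
  assumes "K' \<in> reach A c K" "wf_com k A c" "\<forall>i<k. r i \<in> A"
  shows "next_com K' r \<in> reach A c K \<union> {K, [Halt True], [Halt False]}"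
  using assms(1,2)
proof (induction c arbitrary: K)
  case (Seq a b)
  consider "K' = Seq a b # K" | "K' \<in> reach A a (b # K)" | "K' \<in> reach A b K"
    using Seq(3) by auto
  then show ?case
  proof cases
    case 1
    then show ?thesis
      using Cons_in_reach[of a "b # K" A] by auto
  next
    case 2
    from Seq(1)[OF this] Seq(4) show ?thesis
      using Cons_in_reach[of b K A] by auto
  next
    case 3
    from Seq(2)[OF this] Seq(4) show ?thesis
      by auto
  qed
next
  case (Case i f)
  consider "K' = Case i f # K" | x where "x \<in> A" "K' \<in> reach A (f x) K"
    using Case(2) by auto
  then show ?case
  proof cases
    case 1
    have "r i \<in> A"
      using Case(3) assms(3) by simp
    then show ?thesis
      using 1 Cons_in_reach[of "f (r i)" K A] by auto
  next
    case 2
    have "next_com K' r \<in> reach A (f x) K \<union> {K, [Halt True], [Halt False]}"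
      by (rule Case(1)) (use 2 Case(3) in auto)
    then show ?thesis
      using 2(1) by auto
  qed
next
  case (While i P c)
  then show ?case
    using While(1)[of "While i P c # K"] Cons_in_reach[of c "While i P c # K" A]
    by (auto split: if_splits)
next
  case (Halt b)
  then show ?case
    by (cases b) auto
qed auto

text \<open>The semantics has infinitely many tapes, but a well-formed program depends only on the
  first \<open>k\<close>; this is what allows a machine with \<open>k\<close> tapes to run
  it.\<close>

lemma reach_local:
  assumes "K' \<in> reach A c K" "wf_com k A c" "\<forall>i<k. r i \<in> A" "\<forall>i<k. r i = r' i"
  shows "next_com K' r = next_com K' r' \<and>
    (\<forall>i<k. action K' r i = action K' r' i \<and> fst (action K' r i) \<in> A)"
  using assms(1,2)
proof (induction c arbitrary: K)
  case (Case i f)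
  consider "K' = Case i f # K" | x where "x \<in> A" "K' \<in> reach A (f x) K"
    using Case(2) by auto
  then show ?case
  proof cases
    case 1
    then show ?thesis
      using Case(3) assms(3,4) by auto
  next
    case 2
    show ?thesis
      by (rule Case(1)[of "f x"]) (use 2 Case(3) in auto)
  qed
next
  case (Seq a b)
  consider "K' = Seq a b # K" | "K' \<in> reach A a (b # K)" | "K' \<in> reach A b K"
    using Seq(3) by auto
  then show ?case
  proof cases
    case 1
    then show ?thesis
      using assms(3,4) by auto
  next
    case 2
    from Seq(1)[OF this] Seq(4) show ?thesis
      unfolding wf_com.simps by blast
  next
    case 3
    from Seq(2)[OF this] Seq(4) show ?thesis
      unfolding wf_com.simps by blast
  qed
qed (use assms(3,4) in \<open>auto simp: image_subset_iff\<close>)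

text \<open>\<open>enc\<close> is any numbering of the finitely many stacks. The empty stack is
  among them, as the state in which a program without \<open>Halt\<close> would end.\<close>

locale compiled =
  fixes A :: "'a set" and S :: "'a tape_symbol set" and k :: nat and c :: "'a com"
    and enc :: "'a com list \<Rightarrow> nat"
  assumes fin: "finite S" and alphabet: "insert Blank (Input ` A) \<subseteq> S"
    and k: "k \<ge> 1" and wf: "wf_com k S c"
    and inj: "inj_on enc (insert [] (reach S c [] \<union> {[Halt True], [Halt False]}))"
begin

definition states :: "'a com list set" where
  "states = insert [] (reach S c [] \<union> {[Halt True], [Halt False]})"

definition machine :: "'a turing_machine" where
  "machine = \<lparr> tm_tapes = k, tm_states = enc ` states, tm_alphabet = S,
     tm_start = enc [c], tm_accept = enc [Halt True], tm_reject = enc [Halt False],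
     tm_delta = (\<lambda>q ss. let K = inv_into states enc q in
       (enc (next_com K (\<lambda>i. ss ! i)), map (action K (\<lambda>i. ss ! i)) [0..<k])) \<rparr>"

lemma inj_enc: "inj_on enc states"
  using inj by (simp add: states_def)

lemma in_states: "[c] \<in> states" "[Halt b] \<in> states"
  using Cons_in_reach[of c "[]" S] by (cases b; simp add: states_def)+

lemma inv_enc [simp]: "K \<in> states \<Longrightarrow> inv_into states enc (enc K) = K"
  by (rule inv_into_f_f[OF inj_enc])

lemma state_step:
  assumes "K \<in> states" "\<forall>i<k. r i \<in> S"
  shows "next_com K r \<in> states" "i < k \<Longrightarrow> fst (action K r i) \<in> S"
  using assms next_com_in_reach[of K S c "[]" k r] reach_local[of K S c "[]" k r r] wf
  by (auto simp: states_def)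

lemma state_local:
  assumes "K \<in> states" "\<forall>i<k. r i \<in> S" "\<forall>i<k. r i = r' i"
  shows "next_com K r = next_com K r'" "i < k \<Longrightarrow> action K r i = action K r' i"
  using assms reach_local[of K S c "[]" k r r'] wf by (auto simp: states_def)

lemma tm_wf_machine: "tm_wf A machine"
proof -
  have "finite (enc ` states)"
    by (simp add: states_def finite_reach fin)
  moreover have "enc [Halt True] \<noteq> enc [Halt False]"
    using inj_onD[OF inj_enc _ in_states(2) in_states(2), of True False] by auto
  moreover have "fst (tm_delta machine q ss) \<in> enc ` states \<and>
      snd (tm_delta machine q ss) \<in> lists (S \<times> UNIV) \<and> length (snd (tm_delta machine q ss)) = k"
    if q: "q \<in> enc ` states" and ss: "ss \<in> lists S" "length ss = k" for q ss
  proof -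
    obtain K where K: "K \<in> states" "q = enc K"
      using q by blast
    have r: "\<forall>i<k. ss ! i \<in> S"
      using ss by (auto simp: in_lists_conv_set)
    show ?thesis
      using K state_step[OF K(1) r]
      by (auto simp: machine_def Let_def in_lists_conv_set mem_Times_iff)
  qed
  ultimately show ?thesis
    using k fin alphabet in_states by (simp add: tm_wf_def machine_def)
qed

definition good_tapes :: "(nat \<Rightarrow> 'a tape) \<Rightarrow> bool" where
  "good_tapes tp \<longleftrightarrow> (\<forall>i<k. \<forall>p. fst (tp i) p \<in> S)"

definition simulates :: "'a com list \<times> (nat \<Rightarrow> 'a tape) \<Rightarrow> 'a config \<Rightarrow> bool" where
  "simulates = (\<lambda>(K, tp) C. K \<in> states \<and> good_tapes tp \<and> C = (enc K, map tp [0..<k]))"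

lemma simulates_step:
  assumes "simulates C D"
  shows "simulates (cstep C) (tm_step machine D)"
proof -
  obtain K tp where C: "C = (K, tp)"
    by fastforce
  have K: "K \<in> states" and good: "good_tapes tp" and D: "D = (enc K, map tp [0..<k])"
    using assms by (auto simp: simulates_def C)
  define r where "r = (\<lambda>i. read_tape (tp i))"
  have r: "\<forall>i<k. r i \<in> S"
    using good unfolding r_def good_tapes_def by (metis prod.collapse read_tape.simps)
  define tp' where "tp' = (\<lambda>i. write_tape (tp i) (action K r i))"
  have cstep: "cstep C = (next_com K r, tp')"
    by (simp add: cstep_def C r_def tp'_def Let_def)
  have "fst (tp' i) p \<in> S" if "i < k" for i p
  proof -
    obtain c' h where t: "tp i = (c', h)"
      by fastforce
    obtain x m where a: "action K r i = (x, m)"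
      by fastforce
    have "c' p \<in> S"
      using good that t unfolding good_tapes_def by (metis fst_conv)
    moreover have "x \<in> S"
      using state_step(2)[OF K r that] a by simp
    ultimately show ?thesis
      by (simp add: tp'_def t a)
  qed
  then have good': "good_tapes tp'"
    by (simp add: good_tapes_def)
  have loc: "next_com K r = next_com K (\<lambda>i. map r [0..<k] ! i)"
      "i < k \<Longrightarrow> action K r i = action K (\<lambda>i. map r [0..<k] ! i) i" for i
    using state_local[OF K r, of "\<lambda>i. map r [0..<k] ! i"] by auto
  have "tm_step machine D = (enc (next_com K r), map tp' [0..<k])"
  proof (cases "K = [Halt True] \<or> K = [Halt False]")
    case True
    then have "next_com K r = K" "tp' = tp"
      by (auto simp: tp'_def r_def fun_eq_iff)
    then show ?thesis
      using True D by (auto simp: tm_step_def machine_def)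
  next
    case False
    have ne: "enc K \<noteq> enc [Halt b]" for b
      using False inj_onD[OF inj_enc _ K in_states(2), of b] by (cases b) auto
    have rd: "map read_tape (map tp [0..<k]) = map r [0..<k]"
      by (simp add: r_def)
    have "map2 write_tape (map tp [0..<k]) (map (action K (\<lambda>i. map r [0..<k] ! i)) [0..<k])
        = map tp' [0..<k]"
      using loc(2) by (auto simp: tp'_def list_eq_iff_nth_eq)
    then show ?thesis
      using ne K loc(1) unfolding D tm_step_def
      by (simp add: machine_def Let_def rd del: map_map)
  qed
  then show ?thesis
    using state_step(1)[OF K r] good' by (simp add: simulates_def cstep)
qed

lemma simulates_steps:
  "simulates C D \<Longrightarrow> simulates ((cstep ^^ t) C) ((tm_step machine ^^ t) D)"
  by (induction t) (simp_all add: simulates_step)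

definition init_tapes :: "'a list \<Rightarrow> nat \<Rightarrow> 'a tape" where
  "init_tapes w i = (if i = 0 then input_tape w else (\<lambda>_. Blank, 0))"

lemma simulates_init:
  assumes "w \<in> lists A"
  shows "simulates ([c], init_tapes w) (tm_init machine w)"
proof -
  have "Input (w ! j) \<in> S" if "j < length w" for j
    using alphabet assms that by (auto simp: in_lists_conv_set)
  then have "fst (input_tape w) p \<in> S" for p
    using alphabet by (auto simp: input_tape_def)
  then have good: "good_tapes (init_tapes w)"
    using alphabet by (simp add: good_tapes_def init_tapes_def)
  have "input_tape w # replicate (k - 1) (\<lambda>_. Blank, 0) = map (init_tapes w) [0..<k]"
    using k by (intro nth_equalityI) (auto simp: init_tapes_def nth_Cons')
  then show ?thesis
    using good in_states by (simp add: simulates_def tm_init_def machine_def)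
qed

lemma machine_halts:
  assumes "w \<in> lists A" "fst ((cstep ^^ t) ([c], init_tapes w)) = [Halt b]"
  shows "if b then tm_accepts machine w else tm_rejects machine w"
proof -
  have "simulates ((cstep ^^ t) ([c], init_tapes w)) ((tm_step machine ^^ t) (tm_init machine w))"
    using simulates_steps simulates_init assms(1) by blast
  then have "fst ((tm_step machine ^^ t) (tm_init machine w)) = enc [Halt b]"
    using assms(2) by (auto simp: simulates_def split: prod.splits)
  then show ?thesis
    by (auto simp: tm_accepts_def tm_rejects_def machine_def)
qed

end

subsection \<open>Programs operating on stacks\<close>

text \<open>A stack is stored with its top under the head and extends to the right; so the input tape
  holds the input word as a stack. Cells to the left of the head are arbitrary.\<close>

type_synonym 'a store = "nat \<Rightarrow> 'a list"

definition stack_tape :: "'a list \<Rightarrow> 'a tape \<Rightarrow> bool" where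
  "stack_tape l t \<longleftrightarrow>
    (\<forall>j. fst t (snd t + int j) = (if j < length l then Input (l ! j) else Blank))"

fun top_symbol :: "'a list \<Rightarrow> 'a tape_symbol" where
  "top_symbol [] = Blank"
| "top_symbol (a # l) = Input a"

lemma read_stack_tape: "stack_tape l t \<Longrightarrow> read_tape t = top_symbol l"
  by (cases t; cases l) (force simp: stack_tape_def dest: spec[of _ 0])+

definition represents :: "'a store \<Rightarrow> (nat \<Rightarrow> 'a tape) \<Rightarrow> bool" where
  "represents s tp \<longleftrightarrow> (\<forall>i. stack_tape (s i) (tp i))"

text \<open>Quantifying over the pending work \<open>K\<close> and over all tapes that represent the
  store makes runs composable, whatever lies to the left of the heads.\<close>

definition runs :: "'a com \<Rightarrow> 'a store \<Rightarrow> 'a store \<Rightarrow> bool" where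
  "runs c s s' \<longleftrightarrow> (\<forall>K tp. represents s tp \<longrightarrow>
    (\<exists>t tp'. (cstep ^^ t) (c # K, tp) = (K, tp') \<and> represents s' tp'))"

definition halts :: "'a com \<Rightarrow> 'a store \<Rightarrow> bool \<Rightarrow> bool" where
  "halts c s b \<longleftrightarrow> (\<forall>K tp. represents s tp \<longrightarrow> (\<exists>t. fst ((cstep ^^ t) (c # K, tp)) = [Halt b]))"

lemma represents_read: "represents s tp \<Longrightarrow> read_tape (tp i) = top_symbol (s i)"
  by (simp add: represents_def read_stack_tape)

text \<open>A command other than \<open>Halt\<close> is replaced in one step by at most two
  commands; the three disjuncts are the three possible numbers.\<close>

lemma runs_step:
  assumes "\<And>K tp. represents s tp \<Longrightarrow>
    \<exists>tp' K'. cstep (c # K, tp) = (K' @ K, tp') \<and> represents s' tp' \<and>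
      (K' = [] \<and> s' = s'' \<or> (\<exists>d. K' = [d] \<and> runs d s' s'') \<or>
       (\<exists>d e s1. K' = [d, e] \<and> runs d s' s1 \<and> runs e s1 s''))"
  shows "runs c s s''"
  unfolding runs_def
proof (intro allI impI)
  fix K tp
  assume "represents s tp"
  from assms[OF this, of K] obtain tp' K' where 1: "cstep (c # K, tp) = (K' @ K, tp')"
    "represents s' tp'"
    and 2: "K' = [] \<and> s' = s'' \<or> (\<exists>d. K' = [d] \<and> runs d s' s'') \<or>
       (\<exists>d e s1. K' = [d, e] \<and> runs d s' s1 \<and> runs e s1 s'')"
    by blast
  have "\<exists>t tp''. (cstep ^^ t) (K' @ K, tp') = (K, tp'') \<and> represents s'' tp''"
    using 2
  proof (elim disjE exE conjE)
    assume "K' = []" "s' = s''"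
    then show ?thesis
      using 1 by (intro exI[of _ 0]) auto
  next
    fix d
    assume "K' = [d]" "runs d s' s''"
    then show ?thesis
      using 1 by (auto simp: runs_def)
  next
    fix d e s1
    assume K': "K' = [d, e]" and d: "runs d s' s1" and e: "runs e s1 s''"
    obtain t1 tp1 where t1: "(cstep ^^ t1) (K' @ K, tp') = (e # K, tp1)" "represents s1 tp1"
      using d[unfolded runs_def, rule_format, OF 1(2), of "e # K"] K' by auto
    obtain t2 tp2 where t2: "(cstep ^^ t2) (e # K, tp1) = (K, tp2)" "represents s'' tp2"
      using e[unfolded runs_def, rule_format, OF t1(2), of K] by auto
    have "(cstep ^^ (t2 + t1)) (K' @ K, tp') = (K, tp2)"
      using t1 t2 by (simp add: funpow_add)
    then show ?thesis
      using t2 by blast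
  qed
  then obtain t tp'' where "(cstep ^^ t) (K' @ K, tp') = (K, tp'')" "represents s'' tp''"
    by blast
  then show "\<exists>t tp''. (cstep ^^ t) (c # K, tp) = (K, tp'') \<and> represents s'' tp''"
    using 1 by (intro exI[of _ "Suc t"]) (simp add: funpow_swap1)
qed

lemma halts_step:
  assumes "\<And>K tp. represents s tp \<Longrightarrow>
    \<exists>K' tp'. cstep (c # K, tp) = (d # K' @ K, tp') \<and> represents s' tp'"
    and "halts d s' b"
  shows "halts c s b"
  unfolding halts_def
proof (intro allI impI)
  fix K tp
  assume "represents s tp"
  from assms(1)[OF this, of K] obtain K' tp' where
    1: "cstep (c # K, tp) = (d # K' @ K, tp')" "represents s' tp'"
    by blast
  then obtain t where "fst ((cstep ^^ t) (d # K' @ K, tp')) = [Halt b]"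
    using assms(2) unfolding halts_def by blast
  then show "\<exists>t. fst ((cstep ^^ t) (c # K, tp)) = [Halt b]"
    using 1 by (intro exI[of _ "Suc t"]) (simp add: funpow_swap1)
qed

lemma runs_Skip: "runs Skip s s"
  by (rule runs_step[of _ _ s]) auto

lemma runs_Seq: "runs a s s1 \<Longrightarrow> runs b s1 s2 \<Longrightarrow> runs (Seq a b) s s2"
  by (rule runs_step[of _ _ s]) auto

lemma runs_Case: "runs (f (top_symbol (s i))) s s' \<Longrightarrow> runs (Case i f) s s'"
  by (rule runs_step[of _ _ s]) (auto simp: represents_read)

lemma runs_While_False: "\<not> P (top_symbol (s i)) \<Longrightarrow> runs (While i P c) s s"
  by (rule runs_step[of _ _ s]) (auto simp: represents_read)

lemma runs_While_True:
  "P (top_symbol (s i)) \<Longrightarrow> runs c s s1 \<Longrightarrow> runs (While i P c) s1 s2 \<Longrightarrow> runs (While i P c) s s2"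
  by (rule runs_step[of _ _ s]) (auto simp: represents_read)

lemma halts_Halt: "halts (Halt b) s b"
  unfolding halts_def by (intro allI impI exI[of _ 1]) simp

lemma halts_Seq_left: "halts a s b \<Longrightarrow> halts (Seq a c) s b"
  by (rule halts_step[of s _ a s]) auto

lemma halts_cont:
  assumes "\<And>K tp. represents s tp \<Longrightarrow> \<exists>tp'. cstep (c # K, tp) = (a # d # K, tp') \<and> represents s0 tp'"
    and "runs a s0 s1" "halts d s1 b"
  shows "halts c s b"
  unfolding halts_def
proof (intro allI impI)
  fix K tp
  assume "represents s tp"
  from assms(1)[OF this, of K] obtain tp' where
    1: "cstep (c # K, tp) = (a # d # K, tp')" "represents s0 tp'"
    by blast
  then obtain t1 tp1 where t1: "(cstep ^^ t1) (a # d # K, tp') = (d # K, tp1)" "represents s1 tp1"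
    using assms(2) unfolding runs_def by blast
  then obtain t2 where "fst ((cstep ^^ t2) (d # K, tp1)) = [Halt b]"
    using assms(3) unfolding halts_def by blast
  then have "fst ((cstep ^^ (t2 + t1)) (a # d # K, tp')) = [Halt b]"
    using t1 by (simp add: funpow_add)
  then show "\<exists>t. fst ((cstep ^^ t) (c # K, tp)) = [Halt b]"
    using 1 by (intro exI[of _ "Suc (t2 + t1)"]) (simp add: funpow_swap1)
qed

lemma halts_Seq_right: "runs a s s1 \<Longrightarrow> halts c s1 b \<Longrightarrow> halts (Seq a c) s b"
  by (rule halts_cont[of s _ a c s]) auto

lemma halts_Case: "halts (f (top_symbol (s i))) s b \<Longrightarrow> halts (Case i f) s b"
  by (rule halts_step[of s _ "f (top_symbol (s i))" s]) (auto simp: represents_read)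

lemma halts_While_now: "P (top_symbol (s i)) \<Longrightarrow> halts c s b \<Longrightarrow> halts (While i P c) s b"
  by (rule halts_step[of s _ c s]) (auto simp: represents_read intro!: exI[of _ "[_]"])

lemma halts_While_later:
  "P (top_symbol (s i)) \<Longrightarrow> runs c s s1 \<Longrightarrow> halts (While i P c) s1 b \<Longrightarrow> halts (While i P c) s b"
  by (rule halts_cont[of s _ c "While i P c" s]) (auto simp: represents_read)

section \<open>Elementary stack operations\<close>

definition Push :: "nat \<Rightarrow> 'a \<Rightarrow> 'a com" where
  "Push i a = Seq (Act i (\<lambda>x. x) Left_Move) (Act i (\<lambda>_. Input a) Stay)"

definition Pop :: "nat \<Rightarrow> 'a com" where
  "Pop i = Act i (\<lambda>_. Blank) Right_Move"

lemma stack_tape_push: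
  assumes "stack_tape l (c, h)"
  shows "stack_tape (a # l) (c(h - 1 := Input a), h - 1)"
  unfolding stack_tape_def
proof (intro allI)
  fix j
  show "fst (c(h - 1 := Input a), h - 1) (snd (c(h - 1 := Input a), h - 1) + int j) =
    (if j < length (a # l) then Input ((a # l) ! j) else Blank)"
    using assms by (cases j) (auto simp: stack_tape_def)
qed

lemma stack_tape_pop:
  assumes "stack_tape l (c, h)"
  shows "stack_tape (tl l) (c(h := Blank), h + 1)"
  unfolding stack_tape_def
proof (intro allI)
  fix j
  have "c (h + int (Suc j)) = (if Suc j < length l then Input (l ! Suc j) else Blank)"
    using assms unfolding stack_tape_def fst_conv snd_conv by blast
  then show "fst (c(h := Blank), h + 1) (snd (c(h := Blank), h + 1) + int j) =
    (if j < length (tl l) then Input (tl l ! j) else Blank)"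
    by (auto simp: nth_tl algebra_simps)
qed

lemma runs_Push: "runs (Push i a) s (s(i := a # s i))"
  unfolding runs_def
proof (intro allI impI)
  fix K tp
  assume rep: "represents s tp"
  obtain c h where t: "tp i = (c, h)"
    by fastforce
  have "(cstep ^^ 3) (Push i a # K, tp) = (K, tp(i := (c(h - 1 := Input a), h - 1)))"
    by (simp add: Push_def numeral_3_eq_3 t)
  moreover have "represents (s(i := a # s i)) (tp(i := (c(h - 1 := Input a), h - 1)))"
    using rep t stack_tape_push[of "s i" c h a] by (auto simp: represents_def) metis
  ultimately show "\<exists>t tp'. (cstep ^^ t) (Push i a # K, tp) = (K, tp') \<and>
      represents (s(i := a # s i)) tp'"
    by blast
qed

lemma runs_Pop: "runs (Pop i) s (s(i := tl (s i)))"
  unfolding runs_def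
proof (intro allI impI)
  fix K tp
  assume rep: "represents s tp"
  obtain c h where t: "tp i = (c, h)"
    by fastforce
  have "(cstep ^^ 1) (Pop i # K, tp) = (K, tp(i := (c(h := Blank), h + 1)))"
    by (simp add: Pop_def t)
  moreover have "represents (s(i := tl (s i))) (tp(i := (c(h := Blank), h + 1)))"
    using rep t stack_tape_pop[of "s i" c h] by (auto simp: represents_def) metis
  ultimately show "\<exists>t tp'. (cstep ^^ t) (Pop i # K, tp) = (K, tp') \<and>
      represents (s(i := tl (s i))) tp'"
    by blast
qed

theorem decidable_languageI:
  fixes c :: "'a com"
  assumes "finite A" "L \<subseteq> lists A" and S: "finite S" "insert Blank (Input ` A) \<subseteq> S"
    and k: "k \<ge> 1" "wf_com k S c"
    and halts: "\<And>w. w \<in> lists A \<Longrightarrow> halts c (\<lambda>i. if i = 0 then w else []) (w \<in> L)"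
  shows "decidable_language A L"
proof -
  have "finite (insert [] (reach S c [] \<union> {[Halt True], [Halt False]}))"
    by (simp add: finite_reach S)
  then obtain enc :: "'a com list \<Rightarrow> nat"
    where "inj_on enc (insert [] (reach S c [] \<union> {[Halt True], [Halt False]}))"
    using finite_imp_inj_to_nat_seg by metis
  then interpret compiled A S k c enc
    using S k by unfold_locales
  have "if w \<in> L then tm_accepts machine w else tm_rejects machine w" if w: "w \<in> lists A" for w
  proof -
    have "represents (\<lambda>i. if i = 0 then w else []) (init_tapes w)"
      by (simp add: represents_def stack_tape_def init_tapes_def input_tape_def)
    then obtain t where "fst ((cstep ^^ t) ([c], init_tapes w)) = [Halt (w \<in> L)]"
      using halts[OF w] unfolding halts_def by blast
    then show ?thesis
      by (rule machine_halts[OF w])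
  qed
  then show ?thesis
    using assms(1,2) tm_wf_machine unfolding decidable_language_def by metis
qed

section \<open>Stack programs\<close>

definition For :: "('a \<Rightarrow> bool) \<Rightarrow> nat \<Rightarrow> ('a \<Rightarrow> 'a com) \<Rightarrow> 'a com" where
  "For P i c = While i (\<lambda>x. \<exists>a. x = Input a \<and> P a)
     (Case i (\<lambda>x. case x of Input a \<Rightarrow> Seq (Pop i) (c a) | _ \<Rightarrow> Skip))"

abbreviation Foreach :: "nat \<Rightarrow> ('a \<Rightarrow> 'a com) \<Rightarrow> 'a com" where
  "Foreach \<equiv> For (\<lambda>_. True)"

lemma runs_PushI: "s' = s(i := a # s i) \<Longrightarrow> runs (Push i a) s s'"
  using runs_Push by metis

lemma runs_SkipI: "s = s' \<Longrightarrow> runs Skip s s'"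
  using runs_Skip by metis

lemma runs_For_step:
  assumes "P a" "runs (c a) (s(i := q)) s1" "runs (For P i c) s1 s2"
  shows "runs (For P i c) (s(i := a # q)) s2"
proof -
  let ?body = "Case i (\<lambda>x. case x of Input a \<Rightarrow> Seq (Pop i) (c a) | _ \<Rightarrow> Skip)"
  have "runs (Pop i) (s(i := a # q)) (s(i := q))"
    using runs_Pop[of i "s(i := a # q)"] by simp
  then have "runs (Seq (Pop i) (c a)) (s(i := a # q)) s1"
    using assms(2) by (rule runs_Seq)
  then have "runs ?body (s(i := a # q)) s1"
    by (intro runs_Case) simp
  then show ?thesis
    using assms(3) unfolding For_def
    by (rule runs_While_True[rotated]) (use assms(1) in auto)
qed

text \<open>\<open>G p\<close> is the store after the prefix \<open>p\<close> has been consumed,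
  except that register \<open>i\<close> is overwritten with what is left of it. The loop stops at
  \<open>r\<close>, which is empty or starts with a symbol violating \<open>P\<close>.\<close>

lemma runs_For:
  assumes "s = (G [])(i := l @ r)" "s' = (G l)(i := r)" "\<forall>a\<in>set l. P a" "r = [] \<or> \<not> P (hd r)"
    and body: "\<And>p a q. l = p @ a # q \<Longrightarrow>
      runs (c a) ((G p)(i := q @ r)) ((G (p @ [a]))(i := q @ r))"
  shows "runs (For P i c) s s'"
proof -
  have "runs (For P i c) ((G p)(i := q @ r)) ((G l)(i := r))" if "l = p @ q" for p q
    using that
  proof (induction q arbitrary: p)
    case Nil
    then show ?case
      using assms(4) unfolding For_def by (cases r) (auto intro!: runs_While_False)
  next
    case (Cons a q)
    have "P a"
      using assms(3) Cons(2) by simp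
    moreover have "runs (For P i c) ((G (p @ [a]))(i := q @ r)) ((G l)(i := r))"
      by (rule Cons(1)) (simp add: Cons(2))
    ultimately show ?case
      using runs_For_step[of P a c "G p" i "q @ r", OF _ body[OF Cons(2)]]
      by (simp only: append_Cons)
  qed
  from this[of "[]" l] show ?thesis
    using assms(1,2) by simp
qed

text \<open>The machine halts inside the loop: the rounds for \<open>l\<close> are completed, and
  the body halts at \<open>a\<close>.\<close>

lemma halts_For:
  assumes "s = (G [])(i := l @ a # r)" "\<forall>a\<in>set l. P a" "P a"
    and body: "\<And>p x q. l = p @ x # q \<Longrightarrow>
      runs (c x) ((G p)(i := q @ a # r)) ((G (p @ [x]))(i := q @ a # r))"
    and "halts (c a) ((G l)(i := r)) b"
  shows "halts (For P i c) s b"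
proof -
  let ?body = "Case i (\<lambda>x. case x of Input a \<Rightarrow> Seq (Pop i) (c a) | _ \<Rightarrow> Skip)"
  have pop: "runs (Pop i) (t(i := x # q)) (t(i := q))" for t :: "'a store" and x q
    using runs_Pop[of i "t(i := x # q)"] by simp
  have "halts (For P i c) ((G p)(i := q @ a # r)) b" if "l = p @ q" for p q
    using that
  proof (induction q arbitrary: p)
    case Nil
    have "halts ?body ((G p)(i := a # r)) b"
      using Nil halts_Seq_right[OF pop assms(5)] by (intro halts_Case) simp
    then show ?case
      unfolding For_def append_Nil by (rule halts_While_now[rotated]) (use assms(3) in auto)
  next
    case (Cons x q)
    have *: "runs ?body ((G p)(i := x # q @ a # r)) ((G (p @ [x]))(i := q @ a # r))"
      using runs_Seq[OF pop body[OF Cons(2)]] by (intro runs_Case) simp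
    have "P x"
      using Cons(2) assms(2) by simp
    moreover have "halts (For P i c) ((G (p @ [x]))(i := q @ a # r)) b"
      by (rule Cons(1)) (simp add: Cons(2))
    ultimately show ?case
      unfolding For_def append_Cons by (intro halts_While_later[OF _ *]) auto
  qed
  from this[of "[]" l] show ?thesis
    using assms(1) by simp
qed

lemma wf_Push [simp]: "wf_com k A (Push i a) \<longleftrightarrow> i < k \<and> (A \<noteq> {} \<longrightarrow> Input a \<in> A)"
  by (auto simp: Push_def)

lemma wf_Pop [simp]: "wf_com k A (Pop i) \<longleftrightarrow> i < k \<and> (A \<noteq> {} \<longrightarrow> Blank \<in> A)"
  by (auto simp: Pop_def)

lemma wf_For:
  "i < k \<Longrightarrow> Blank \<in> A \<Longrightarrow> (\<And>a. Input a \<in> A \<Longrightarrow> wf_com k A (c a)) \<Longrightarrow> wf_com k A (For P i c)"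
  by (auto simp: For_def split: tape_symbol.split)

section \<open>Moving, clearing and traversing stacks\<close>

primrec pushes :: "nat \<Rightarrow> 'a list \<Rightarrow> 'a com" where
  "pushes i [] = Skip"
| "pushes i (a # l) = Seq (Push i a) (pushes i l)"

lemma runs_pushes: "s' = s(i := rev l @ s i) \<Longrightarrow> runs (pushes i l) s s'"
proof (induction l arbitrary: s)
  case Nil
  then show ?case
    by (auto intro: runs_SkipI)
next
  case (Cons a l)
  show ?case
    unfolding pushes.simps by (rule runs_Seq[OF runs_PushI[OF HOL.refl]]) (rule Cons(1), simp add: Cons(2) fun_eq_iff)
qed

lemma wf_pushes: "i < k \<Longrightarrow> Input ` set l \<subseteq> A \<Longrightarrow> wf_com k A (pushes i l)"
  by (induction l) auto

definition move :: "nat \<Rightarrow> nat \<Rightarrow> 'a com" where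
  "move i j = Foreach i (Push j)"

lemma runs_move:
  assumes "i \<noteq> j" "s' = s(i := [], j := rev (s i) @ s j)"
  shows "runs (move i j) s s'"
  unfolding move_def
  by (rule runs_For[where G = "\<lambda>p. s(j := rev p @ s j)" and l = "s i" and r = "[]"])
    (use assms in \<open>auto simp: fun_eq_iff intro!: runs_PushI\<close>)

definition clear :: "nat \<Rightarrow> 'a com" where
  "clear i = Foreach i (\<lambda>_. Skip)"

lemma runs_clear: "s' = s(i := []) \<Longrightarrow> runs (clear i) s s'"
  unfolding clear_def
  by (rule runs_For[where G = "\<lambda>p. s" and l = "s i" and r = "[]"])
    (auto simp: fun_eq_iff intro!: runs_SkipI)

text \<open>Reading a stack destroys it, so its symbols are saved in reverse order on
  \<open>t\<close> and moved back at the end.\<close>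

definition traverse :: "nat \<Rightarrow> nat \<Rightarrow> ('a \<Rightarrow> 'a com) \<Rightarrow> 'a com" where
  "traverse i t c = Seq (Foreach i (\<lambda>a. Seq (Push t a) (c a))) (move t i)"

lemma runs_traverse:
  assumes "i \<noteq> t" "s = G []" "s' = G (s i)" "\<And>p. G p i = s i" "\<And>p. G p t = []"
    and body: "\<And>p a q u v. s i = p @ a # q \<Longrightarrow>
      runs (c a) ((G p)(i := u, t := v)) ((G (p @ [a]))(i := u, t := v))"
  shows "runs (traverse i t c) s s'"
  unfolding traverse_def
proof (rule runs_Seq)
  let ?l = "s i"
  show "runs (Foreach i (\<lambda>a. Seq (Push t a) (c a))) s ((G ?l)(i := [], t := rev ?l))"
  proof (rule runs_For[where G = "\<lambda>p. (G p)(t := rev p)" and l = ?l and r = "[]"])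
    show "s = ((G [])(t := rev []))(i := ?l @ [])"
      using assms(1,2) assms(4,5)[of "[]"] by (auto simp: fun_eq_iff)
    show "(G ?l)(i := [], t := rev ?l) = ((G ?l)(t := rev ?l))(i := [])"
      using assms(1) by (auto simp: fun_eq_iff)
    fix p a q
    assume "?l = p @ a # q"
    from body[OF this, of q "a # rev p"]
    show "runs (Seq (Push t a) (c a)) (((G p)(t := rev p))(i := q @ []))
        (((G (p @ [a]))(t := rev (p @ [a])))(i := q @ []))"
      using assms(1) by (intro runs_Seq[OF runs_PushI[OF HOL.refl]]) (simp add: fun_upd_twist)
  qed auto
  show "runs (move t i) ((G ?l)(i := [], t := rev ?l)) s'"
    using assms(1,3-5) by (intro runs_move) (auto simp: fun_eq_iff)
qed

lemma wf_move: "i < k \<Longrightarrow> j < k \<Longrightarrow> Blank \<in> A \<Longrightarrow> wf_com k A (move i j)"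
  unfolding move_def by (rule wf_For) auto

lemma wf_clear: "i < k \<Longrightarrow> Blank \<in> A \<Longrightarrow> wf_com k A (clear i)"
  unfolding clear_def by (rule wf_For) auto

lemma wf_traverse:
  "i < k \<Longrightarrow> t < k \<Longrightarrow> Blank \<in> A \<Longrightarrow> (\<And>a. Input a \<in> A \<Longrightarrow> wf_com k A (c a)) \<Longrightarrow>
    wf_com k A (traverse i t c)"
  unfolding traverse_def by (auto intro!: wf_For wf_move)

subsection \<open>Testing whether a braid acts trivially\<close>

fun art_gen :: "letter \<Rightarrow> nat \<Rightarrow> nat word" where
  "art_gen (i, True) j = (if j = i then [(Suc i, True)]
     else if j = Suc i then [(Suc i, False), (i, True), (Suc i, True)] else [(j, True)])"
| "art_gen (i, False) j = (if j = i then [(i, True), (Suc i, True), (i, False)]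
     else if j = Suc i then [(i, True)] else [(j, True)])"

definition art :: "letter \<Rightarrow> letter \<Rightarrow> nat word" where
  "art l = (\<lambda>(j, b). if b then art_gen l j else winv (art_gen l j))"

definition subst_word :: "letter \<Rightarrow> nat word \<Rightarrow> nat word" where
  "subst_word l w = concat (map (art l) w)"

lemma wval_art_gen: "wval gen (art_gen l j) = app (lval sigma l) (gen j)"
  by (cases "(l, j)" rule: art_gen.cases)
    (simp_all add: app_sigma app_uminus_sigma add.assoc
      diff_conv_add_uminus del: add_uminus_conv_diff)

lemma wval_subst_word: "wval gen (subst_word l w) = app (lval sigma l) (wval gen w)"
proof (induction w)
  case Nil
  show ?case
    using additive_rho[of "[l]"] by (simp add: subst_word_def additiveD(2))
next
  case (Cons a w)
  have add: "additive (app (lval sigma l))"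
    using additive_rho[of "[l]"] by simp
  have "wval gen (art l a) = app (lval sigma l) (lval gen a)"
    using additiveD(3)[OF add] by (cases a) (simp add: art_def wval_art_gen)
  then show ?case
    using Cons additiveD(1)[OF add] by (simp add: subst_word_def)
qed

definition act_word :: "nat word \<Rightarrow> nat \<Rightarrow> nat word" where
  "act_word z i = foldl (\<lambda>w l. subst_word l w) [(i, True)] z"

text \<open>The letters of \<open>z\<close> are applied one after another, whereas in a sum of
  bijections the last summand acts first. This is why \<open>z\<close> is reversed, and why braid
  words are kept reversed in the registers.\<close>

lemma wval_act_word: "wval gen (act_word z i) = app (wval sigma (rev z)) (gen i)"
  by (induction z rule: rev_induct) (simp_all add: act_word_def wval_subst_word)

type_synonym prog = "letter option com"

definition subst_com :: "letter \<Rightarrow> prog" where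
  "subst_com l = Seq (Foreach 7 (\<lambda>a. case a of None \<Rightarrow> Skip | Some t \<Rightarrow> pushes 8 (map Some (art l t))))
     (move 8 7)"

lemma runs_subst_com:
  assumes "s 7 = map Some w" "s 8 = []" "s' = s(7 := map Some (subst_word l w))"
  shows "runs (subst_com l) s s'"
  unfolding subst_com_def
proof (rule runs_Seq)
  show "runs (Foreach 7 (\<lambda>a. case a of None \<Rightarrow> Skip | Some t \<Rightarrow> pushes 8 (map Some (art l t)))) s
    (s(7 := [], 8 := rev (map Some (subst_word l w))))"
    by (rule runs_For[where G = "\<lambda>p. s(8 := rev (map Some (subst_word l (map the p))))"
          and l = "map Some w" and r = "[]"])
      (use assms(1,2) in \<open>auto simp: fun_eq_iff comp_def subst_word_def map_eq_append_conv
          intro!: runs_pushes\<close>)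
  show "runs (move 8 7) (s(7 := [], 8 := rev (map Some (subst_word l w)))) s'"
    by (rule runs_move) (use assms in \<open>auto simp: fun_eq_iff\<close>)
qed

definition push_com :: "letter \<Rightarrow> prog" where
  "push_com a = Case 8 (\<lambda>x. if x = Input (Some (flip a)) then Pop 8 else Push 8 (Some a))"

lemma runs_push_com:
  assumes "s 8 = map Some u" "s' = s(8 := map Some (push a u))"
  shows "runs (push_com a) s s'"
  unfolding push_com_def
proof (rule runs_Case)
  show "runs (if top_symbol (s 8) = Input (Some (flip a)) then Pop 8 else Push 8 (Some a)) s s'"
    using assms runs_Pop[of 8 s] by (cases u) (auto intro!: runs_PushI)
qed

text \<open>Register 7 receives the unreduced image of \<open>gen i\<close>. Pushing its inverse
  letters one by one, with cancellation, onto \<open>gen i\<close> in register 8 leaves a reduced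
  word that is empty exactly if \<open>gen i\<close> is fixed. The test \<open>fst l < n\<close>
  keeps the substituted words within the work alphabet, whichever symbol of that alphabet is
  read.\<close>

definition test_gen :: "nat \<Rightarrow> nat \<Rightarrow> nat \<Rightarrow> prog" where
  "test_gen n z i =
    Seq (Push 7 (Some (i, True)))
   (Seq (traverse z 9 (\<lambda>a. case a of None \<Rightarrow> Skip | Some l \<Rightarrow> if fst l < n then subst_com l else Skip))
   (Seq (Push 8 (Some (i, True)))
   (Seq (Foreach 7 (\<lambda>a. case a of None \<Rightarrow> Skip | Some t \<Rightarrow> push_com (flip t)))
   (Seq (Case 8 (\<lambda>x. if x = Blank then Skip else Push 10 None)) (clear 8)))))"

definition fixes_gen :: "nat word \<Rightarrow> nat \<Rightarrow> bool" where
  "fixes_gen w i \<longleftrightarrow> app (wval sigma w) (gen i) = gen i"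

definition scratch_empty :: "letter option store \<Rightarrow> bool" where
  "scratch_empty s \<longleftrightarrow> s 7 = [] \<and> s 8 = [] \<and> s 9 = []"

lemma runs_test_gen:
  assumes z: "z < 7" "s z = map Some (rev w)" "w \<in> braid_words n"
    and s: "scratch_empty s"
    and s': "s' = (if fixes_gen w i then s else s(10 := None # s 10))"
  shows "runs (test_gen n z i) s s'"
proof -
  define v where "v = act_word (rev w) i"
  define u where "u = foldr push (winv v) [(i, True)]"
  have u: "u = [] \<longleftrightarrow> fixes_gen w i"
  proof -
    have "u = red (winv v @ [(i, True)])"
      by (simp add: u_def red_def)
    then have "u = [] \<longleftrightarrow> - wval gen v + gen i = 0"
      using red_eq_Nil_iff[of "winv v @ [(i, True)]"] by simp
    also have "\<dots> \<longleftrightarrow> wval gen v = gen i"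
      by (metis add_minus_cancel add_0_right left_minus)
    finally show ?thesis
      by (simp add: fixes_gen_def v_def wval_act_word)
  qed
  have letters: "fst l < n" if "l \<in> set w" for l
    using z(3) that by (auto simp: letters_def braid_gens_def)
  let ?s1 = "s(7 := map Some v)"
  show ?thesis
    unfolding test_gen_def
  proof (intro runs_Seq)
    show "runs (Push 7 (Some (i, True))) s (s(7 := [Some (i, True)]))"
      using s by (intro runs_PushI) (simp add: scratch_empty_def)
    show "runs (traverse z 9 (\<lambda>a. case a of None \<Rightarrow> Skip
        | Some l \<Rightarrow> if fst l < n then subst_com l else Skip)) (s(7 := [Some (i, True)])) ?s1"
    proof (rule runs_traverse[where G = "\<lambda>p. s(7 := map Some (act_word (map the p) i))"])
      fix p a q and x y :: "letter option list"
      assume "(s(7 := [Some (i, True)])) z = p @ a # q"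
      then have "map Some (rev w) = p @ a # q"
        using z by simp
      then obtain l where l: "a = Some l" "l \<in> set w"
        by (metis (no_types, lifting) image_iff in_set_conv_decomp list.set_map set_rev)
      show "runs (case a of None \<Rightarrow> Skip | Some l \<Rightarrow> if fst l < n then subst_com l else Skip)
          ((s(7 := map Some (act_word (map the p) i)))(z := x, 9 := y))
          ((s(7 := map Some (act_word (map the (p @ [a])) i)))(z := x, 9 := y))"
        unfolding l(1) option.case if_P[OF letters[OF l(2)]]
        by (rule runs_subst_com[where w = "act_word (map the p) i"])
          (use z s in \<open>auto simp: scratch_empty_def act_word_def fun_eq_iff\<close>)
    qed (use z s in \<open>auto simp: scratch_empty_def v_def act_word_def comp_def\<close>)
    show "runs (Push 8 (Some (i, True))) ?s1 (?s1(8 := [Some (i, True)]))"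
      using s by (intro runs_PushI) (simp add: scratch_empty_def)
    show "runs (Foreach 7 (\<lambda>a. case a of None \<Rightarrow> Skip | Some t \<Rightarrow> push_com (flip t)))
        (?s1(8 := [Some (i, True)])) (s(8 := map Some u))"
    proof (rule runs_For[where
          G = "\<lambda>p. s(8 := map Some (foldr push (winv (map the p)) [(i, True)]))"
          and l = "map Some v" and r = "[]"])
      fix p a q
      assume "map Some v = p @ a # q"
      then obtain t where t: "a = Some t"
        by (auto simp: map_eq_append_conv)
      show "runs (case a of None \<Rightarrow> Skip | Some t \<Rightarrow> push_com (flip t))
          ((s(8 := map Some (foldr push (winv (map the p)) [(i, True)])))(7 := q @ []))
          ((s(8 := map Some (foldr push (winv (map the (p @ [a]))) [(i, True)])))(7 := q @ []))"
        unfolding t option.case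
        by (rule runs_push_com[where u = "foldr push (winv (map the p)) [(i, True)]"])
          (auto simp: fun_eq_iff)
    qed (use s in \<open>auto simp: scratch_empty_def u_def comp_def fun_eq_iff\<close>)
    show "runs (Case 8 (\<lambda>x. if x = Blank then Skip else Push 10 None)) (s(8 := map Some u))
        (s'(8 := map Some u))"
      by (rule runs_Case)
        (cases u; use u s' in \<open>auto simp: fun_upd_twist intro!: runs_PushI runs_SkipI\<close>)
    show "runs (clear 8) (s'(8 := map Some u)) s'"
      by (rule runs_clear) (use s s' in \<open>auto simp: scratch_empty_def fun_eq_iff\<close>)
  qed
qed

primrec test_gens :: "nat \<Rightarrow> nat \<Rightarrow> nat list \<Rightarrow> prog" where
  "test_gens n z [] = Skip"
| "test_gens n z (i # is) = Seq (test_gen n z i) (test_gens n z is)"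

lemma runs_test_gens:
  assumes "z < 7" "s z = map Some (rev w)" "w \<in> braid_words n" "scratch_empty s"
    and "s' = s(10 := replicate (length (filter (\<lambda>i. \<not> fixes_gen w i) is)) None @ s 10)"
  shows "runs (test_gens n z is) s s'"
  using assms(2,4,5)
proof (induction "is" arbitrary: s)
  case Nil
  then show ?case
    by (auto intro: runs_SkipI)
next
  case (Cons i "is")
  let ?s1 = "if fixes_gen w i then s else s(10 := None # s 10)"
  have "runs (test_gen n z i) s ?s1"
    using assms(1,3) Cons(2,3) by (intro runs_test_gen[where w = w]) auto
  moreover have "runs (test_gens n z is) ?s1 s'"
    using assms(1) Cons(2-4)
    by (intro Cons(1)) (auto simp: scratch_empty_def replicate_app_Cons_same)
  ultimately show ?case
    by (auto intro: runs_Seq)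
qed

definition accept_if_trivial :: "nat \<Rightarrow> nat \<Rightarrow> prog" where
  "accept_if_trivial n z = Seq (test_gens n z [1..<Suc n])
     (Seq (Case 10 (\<lambda>x. if x = Blank then Halt True else Skip)) (clear 10))"

lemma accept_if_trivial:
  assumes "z < 7" "s z = map Some (rev w)" "w \<in> braid_words n" "scratch_empty s" "s 10 = []"
  shows "acts_trivially n w \<Longrightarrow> halts (accept_if_trivial n z) s True"
    and "\<not> acts_trivially n w \<Longrightarrow> runs (accept_if_trivial n z) s s"
proof -
  let ?N = "length (filter (\<lambda>i. \<not> fixes_gen w i) [1..<Suc n])"
  have run: "runs (test_gens n z [1..<Suc n]) s (s(10 := replicate ?N None))"
    by (rule runs_test_gens) (use assms in auto)
  have N: "?N = 0 \<longleftrightarrow> acts_trivially n w"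
    by (auto simp: acts_trivially_def fixes_gen_def filter_empty_conv simp del: upt_Suc)
  show "halts (accept_if_trivial n z) s True" if "acts_trivially n w"
    unfolding accept_if_trivial_def
  proof (rule halts_Seq_right[OF run], rule halts_Seq_left, rule halts_Case)
    have "?N = 0"
      using that N by simp
    then show "halts (if top_symbol ((s(10 := replicate ?N None)) 10) = Blank then Halt True else Skip)
        (s(10 := replicate ?N None)) True"
      by (simp only: replicate_0 fun_upd_same top_symbol.simps if_True simp_thms halts_Halt)
  qed
  show "runs (accept_if_trivial n z) s s" if "\<not> acts_trivially n w"
    unfolding accept_if_trivial_def
  proof (rule runs_Seq[OF run], rule runs_Seq)
    have "?N \<noteq> 0"
      using that unfolding N .
    then obtain m where "?N = Suc m"
      by (rule not0_implies_Suc[THEN exE])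
    then show "runs (Case 10 (\<lambda>x. if x = Blank then Halt True else Skip)) (s(10 := replicate ?N None))
        (s(10 := replicate ?N None))"
      by (intro runs_Case) (simp add: runs_Skip del: upt_Suc)
    show "runs (clear 10) (s(10 := replicate ?N None)) s"
      by (rule runs_clear) (use assms(5) in \<open>auto simp: fun_eq_iff\<close>)
  qed
qed

subsection \<open>The decision procedure\<close>

text \<open>Register use: 0 input, 1 and 2 the words \<open>x\<close> and \<open>x\<inverse>\<close>, 3 the word \<open>y\<close>, 4 a unary
  counter, 5 and 6 the words \<open>y x\<^sup>-\<^sup>k\<close> and \<open>y x\<^sup>k\<close> (all words reversed), 7 to 9 scratch space,
  10 a failure flag.\<close>

definition append_inverse :: "nat \<Rightarrow> nat \<Rightarrow> prog" where
  "append_inverse i j = traverse i 9 (\<lambda>a. Push j (map_option flip a))"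

text \<open>As words are stored reversed, pushing the flipped letters of \<open>v\<close> from top
  to bottom appends its inverse at the right end of \<open>w\<close>.\<close>

lemma runs_append_inverse:
  assumes "i < 7" "j < 7" "i \<noteq> j" "s i = map Some (rev v)" "s j = map Some (rev w)" "s 9 = []"
    and "s' = s(j := map Some (rev (w @ winv v)))"
  shows "runs (append_inverse i j) s s'"
  unfolding append_inverse_def
  by (rule runs_traverse[where G = "\<lambda>p. s(j := rev (map (map_option flip) p) @ s j)"])
    (use assms in \<open>auto simp: fun_eq_iff winv_def rev_map[symmetric] comp_def intro!: runs_PushI\<close>)

definition check_and_multiply :: "nat \<Rightarrow> nat \<Rightarrow> nat \<Rightarrow> prog" where
  "check_and_multiply n i j = Seq (accept_if_trivial n j) (append_inverse i j)"

lemma check_and_multiply: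
  assumes "i < 7" "j < 7" "i \<noteq> j" "s i = map Some (rev v)" "s j = map Some (rev w)"
    and "scratch_empty s" "s 10 = []" "w \<in> braid_words n"
  shows "acts_trivially n w \<Longrightarrow> halts (check_and_multiply n i j) s True"
    and "\<not> acts_trivially n w \<Longrightarrow> s' = s(j := map Some (rev (w @ winv v))) \<Longrightarrow>
      runs (check_and_multiply n i j) s s'"
proof -
  assume "acts_trivially n w"
  with assms show "halts (check_and_multiply n i j) s True"
    unfolding check_and_multiply_def by (intro halts_Seq_left accept_if_trivial(1)[of _ _ w]) auto
next
  assume "\<not> acts_trivially n w" and s': "s' = s(j := map Some (rev (w @ winv v)))"
  then have "runs (accept_if_trivial n j) s s"
    using assms by (intro accept_if_trivial(2)[of _ _ w]) auto
  moreover have "runs (append_inverse i j) s s'"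
    by (rule runs_append_inverse[where v = v and w = w]) (use assms s' in \<open>auto simp: scratch_empty_def\<close>)
  ultimately show "runs (check_and_multiply n i j) s s'"
    unfolding check_and_multiply_def by (rule runs_Seq)
qed

definition multiply_counter :: "nat \<Rightarrow> prog" where
  "multiply_counter B = Seq (Foreach 4 (\<lambda>_. pushes 8 (replicate B None))) (move 8 4)"

lemma runs_multiply_counter:
  assumes "s 4 = replicate m None" "s 8 = []" "s' = s(4 := replicate (B * m) None)"
  shows "runs (multiply_counter B) s s'"
  unfolding multiply_counter_def
proof (rule runs_Seq)
  show "runs (Foreach 4 (\<lambda>_. pushes 8 (replicate B None))) s
    (s(4 := [], 8 := replicate (B * m) None))"
    by (rule runs_For[where G = "\<lambda>p. s(8 := replicate (B * length p) None)"
          and l = "s 4" and r = "[]"])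
      (use assms(1,2) in \<open>auto simp: fun_eq_iff replicate_add intro!: runs_pushes\<close>)
  show "runs (move 8 4) (s(4 := [], 8 := replicate (B * m) None)) s'"
    by (rule runs_move) (use assms in \<open>auto simp: fun_eq_iff\<close>)
qed

text \<open>The power is computed in unary, by one multiplication for each letter of
  \<open>y\<close>. The additional mark accounts for the exponent 0, which is tested as
  well.\<close>

definition set_counter :: "nat \<Rightarrow> prog" where
  "set_counter B = Seq (pushes 4 (replicate B None))
     (Seq (traverse 3 9 (\<lambda>_. multiply_counter B)) (Push 4 None))"

lemma runs_set_counter:
  assumes "s 4 = []" "s 8 = []" "s 9 = []"
    and "s' = s(4 := replicate (Suc (B ^ Suc (length (s 3)))) None)"
  shows "runs (set_counter B) s s'"
  unfolding set_counter_def
proof (intro runs_Seq)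
  show "runs (pushes 4 (replicate B None)) s (s(4 := replicate B None))"
    by (rule runs_pushes) (use assms in simp)
  show "runs (traverse 3 9 (\<lambda>_. multiply_counter B)) (s(4 := replicate B None))
    (s(4 := replicate (B ^ Suc (length (s 3))) None))"
    by (rule runs_traverse[where G = "\<lambda>p. s(4 := replicate (B ^ Suc (length p)) None)"])
      (use assms in \<open>auto simp: fun_eq_iff intro!: runs_multiply_counter\<close>)
  show "runs (Push 4 None) (s(4 := replicate (B ^ Suc (length (s 3))) None)) s'"
    by (rule runs_PushI) (use assms in \<open>auto simp: fun_eq_iff\<close>)
qed

section \<open>Parsing the input\<close>

definition parse :: prog where
  "parse =
    Seq (For (\<lambda>a. a \<noteq> None) 0 (Push 1))
   (Seq (Case 0 (\<lambda>x. if x = Input None then Pop 0 else Halt False))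
   (Seq (For (\<lambda>a. a \<noteq> None) 0 (\<lambda>a. Seq (Push 3 a) (Seq (Push 5 a) (Push 6 a))))
        (Case 0 (\<lambda>x. if x = Blank then Skip else Halt False))))"

definition input_store :: "letter option list \<Rightarrow> letter option store" where
  "input_store w i = (if i = 0 then w else [])"

definition parsed_store :: "nat word \<Rightarrow> nat word \<Rightarrow> letter option store" where
  "parsed_store x y = (\<lambda>_. [])(1 := map Some (rev x), 3 := map Some (rev y),
     5 := map Some (rev y), 6 := map Some (rev y))"

lemma runs_parse_first:
  assumes "r = [] \<or> hd r = None"
  shows "runs (For (\<lambda>a. a \<noteq> None) 0 (Push 1)) (input_store (map Some x @ r))
    ((input_store r)(1 := map Some (rev x)))"
  by (rule runs_For[where G = "\<lambda>p. (input_store [])(1 := rev p)" and l = "map Some x" and r = r])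
    (use assms in \<open>auto simp: fun_eq_iff input_store_def rev_map intro!: runs_PushI\<close>)

lemma runs_parse_second:
  assumes "r = [] \<or> hd r = None"
  shows "runs (For (\<lambda>a. a \<noteq> None) 0 (\<lambda>a. Seq (Push 3 a) (Seq (Push 5 a) (Push 6 a))))
    ((input_store (map Some y @ r))(1 := map Some (rev x))) ((parsed_store x y)(0 := r))"
proof (rule runs_For[where l = "map Some y" and r = r and
      G = "\<lambda>p. (input_store [])(1 := map Some (rev x), 3 := rev p, 5 := rev p, 6 := rev p)"])
  fix p a q
  show "runs (Seq (Push 3 a) (Seq (Push 5 a) (Push 6 a)))
      (((input_store [])(1 := map Some (rev x), 3 := rev p, 5 := rev p, 6 := rev p))(0 := q @ r))
      (((input_store [])(1 := map Some (rev x), 3 := rev (p @ [a]), 5 := rev (p @ [a]),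
        6 := rev (p @ [a])))(0 := q @ r))"
    by (intro runs_Seq, (rule runs_PushI, rule HOL.refl)+, rule runs_PushI) (auto simp: fun_eq_iff)
qed (use assms in \<open>auto simp: fun_eq_iff input_store_def parsed_store_def rev_map\<close>)

lemma parse_no_separator: "halts parse (input_store (map Some x)) False"
  unfolding parse_def
proof (rule halts_Seq_right)
  show "runs (For (\<lambda>a. a \<noteq> None) 0 (Push 1)) (input_store (map Some x))
      ((input_store [])(1 := map Some (rev x)))"
    using runs_parse_first[of "[]" x] by simp
qed (rule halts_Seq_left, rule halts_Case, simp add: input_store_def halts_Halt)

lemma runs_parse_separator:
  "runs (Case 0 (\<lambda>x. if x = Input None then Pop 0 else Halt False))
    ((input_store (None # r))(1 := v)) ((input_store r)(1 := v))"
proof (rule runs_Case)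
  have "((input_store (None # r))(1 := v))(0 := tl (((input_store (None # r))(1 := v)) 0))
      = (input_store r)(1 := v)"
    by (auto simp: fun_eq_iff input_store_def)
  then show "runs (if top_symbol (((input_store (None # r))(1 := v)) 0) = Input None
      then Pop 0 else Halt False) ((input_store (None # r))(1 := v)) ((input_store r)(1 := v))"
    using runs_Pop[of 0 "(input_store (None # r))(1 := v)"] by (simp add: input_store_def)
qed

lemma parse_two_separators:
  "halts parse (input_store (map Some x @ None # map Some y @ None # r)) False"
  unfolding parse_def
proof (rule halts_Seq_right[OF runs_parse_first], simp,
    rule halts_Seq_right[OF runs_parse_separator],
    rule halts_Seq_right[OF runs_parse_second], simp)
qed (rule halts_Case, simp add: halts_Halt)

lemma runs_parse:
  "runs parse (input_store (map Some x @ None # map Some y)) (parsed_store x y)"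
  unfolding parse_def
proof (rule runs_Seq[OF runs_parse_first], simp,
    rule runs_Seq[OF runs_parse_separator], rule runs_Seq)
  show "runs (For (\<lambda>a. a \<noteq> None) 0 (\<lambda>a. Seq (Push 3 a) (Seq (Push 5 a) (Push 6 a))))
    ((input_store (map Some y))(1 := map Some (rev x))) ((parsed_store x y)(0 := []))"
    using runs_parse_second[of "[]" y x] by simp
qed (rule runs_Case, auto simp: parsed_store_def fun_eq_iff intro!: runs_SkipI)

section \<open>The search through the exponents\<close>

definition search_body :: "bool \<Rightarrow> nat \<Rightarrow> prog" where
  "search_body both n =
    Seq (check_and_multiply n 1 5) (if both then check_and_multiply n 2 6 else Skip)"

definition decide :: "bool \<Rightarrow> nat \<Rightarrow> nat \<Rightarrow> prog" where
  "decide both B n = Seq parse (Seq (append_inverse 1 2) (Seq (set_counter B)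
     (Seq (Foreach 4 (\<lambda>_. search_body both n)) (Halt False))))"

definition power_word :: "nat word \<Rightarrow> nat word \<Rightarrow> nat \<Rightarrow> nat word" where
  "power_word x y k = y @ concat (replicate k (winv x))"

lemma power_word_Suc: "power_word x y (Suc k) = power_word x y k @ winv x"
proof -
  have "concat (replicate (Suc k) v) = concat (replicate k v) @ v" for v :: "nat word"
    by (induction k) simp_all
  then show ?thesis
    by (simp add: power_word_def)
qed

text \<open>If only nonnegative powers are searched, register 6 keeps its initial word
  \<open>y\<close>, which is the power word with exponent 0.\<close>

definition search_store :: "bool \<Rightarrow> nat word \<Rightarrow> nat word \<Rightarrow> nat \<Rightarrow> letter option store" where
  "search_store both x y k = (\<lambda>_. [])(1 := map Some (rev x), 2 := map Some (rev (winv x)),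
     3 := map Some (rev y), 5 := map Some (rev (power_word x y k)),
     6 := map Some (rev (power_word (winv x) y (if both then k else 0))))"

definition found :: "bool \<Rightarrow> nat \<Rightarrow> nat word \<Rightarrow> nat word \<Rightarrow> nat \<Rightarrow> bool" where
  "found both n x y k \<longleftrightarrow> acts_trivially n (power_word x y k)
     \<or> both \<and> acts_trivially n (power_word (winv x) y k)"

lemma search_body:
  assumes xy: "x \<in> braid_words n" "y \<in> braid_words n"
  shows "found both n x y k \<Longrightarrow> halts (search_body both n) ((search_store both x y k)(4 := c)) True"
    and "\<not> found both n x y k \<Longrightarrow> runs (search_body both n)
      ((search_store both x y k)(4 := c)) ((search_store both x y (Suc k))(4 := c))"
proof -
  let ?s = "(search_store both x y k)(4 := c)"
  let ?s1 = "?s(5 := map Some (rev (power_word x y (Suc k))))"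
  have words: "power_word x y k \<in> braid_words n" "power_word (winv x) y k \<in> braid_words n"
    using xy by (simp_all add: power_word_def)
  have first: "acts_trivially n (power_word x y k) \<Longrightarrow> halts (check_and_multiply n 1 5) ?s True"
    "\<not> acts_trivially n (power_word x y k) \<Longrightarrow> runs (check_and_multiply n 1 5) ?s ?s1"
    using check_and_multiply[of 1 5 ?s x "power_word x y k" n] words
    by (auto simp: search_store_def scratch_empty_def power_word_Suc)
  have second: "both \<Longrightarrow> acts_trivially n (power_word (winv x) y k) \<Longrightarrow>
      halts (check_and_multiply n 2 6) ?s1 True"
    "both \<Longrightarrow> \<not> acts_trivially n (power_word (winv x) y k) \<Longrightarrow> runs (check_and_multiply n 2 6) ?s1
      (?s1(6 := map Some (rev (power_word (winv x) y (Suc k)))))"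
    using check_and_multiply[of 2 6 ?s1 "winv x" "power_word (winv x) y k" n] words
    by (auto simp: search_store_def scratch_empty_def power_word_Suc)
  show "halts (search_body both n) ?s True" if "found both n x y k"
  proof (cases "acts_trivially n (power_word x y k)")
    case True
    then show ?thesis
      unfolding search_body_def by (intro halts_Seq_left first(1))
  next
    case False
    then show ?thesis
      using that second(1) unfolding search_body_def
      by (intro halts_Seq_right[OF first(2)]) (auto simp: found_def)
  qed
  show "runs (search_body both n) ?s ((search_store both x y (Suc k))(4 := c))"
    if nf: "\<not> found both n x y k"
    unfolding search_body_def
  proof (rule runs_Seq[OF first(2)])
    show "\<not> acts_trivially n (power_word x y k)"
      using nf by (simp add: found_def)
    show "runs (if both then check_and_multiply n 2 6 else Skip) ?s1
        ((search_store both x y (Suc k))(4 := c))"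
    proof (cases both)
      case True
      have "?s1(6 := map Some (rev (power_word (winv x) y (Suc k))))
          = (search_store both x y (Suc k))(4 := c)"
        using True by (simp add: search_store_def fun_eq_iff)
      then show ?thesis
        using second(2) True nf by (simp add: found_def)
    next
      case False
      then show ?thesis
        by (auto simp: search_store_def fun_eq_iff intro!: runs_SkipI)
    qed
  qed
qed

lemma halts_decide:
  assumes "x \<in> braid_words n" "y \<in> braid_words n"
  shows "halts (decide both B n) (input_store (encode_pair x y))
    (\<exists>k\<le>B ^ Suc (length y). found both n x y k)"
proof -
  define N where "N = B ^ Suc (length y)"
  have prefix: "halts (decide both B n) (input_store (encode_pair x y)) b"
    if "halts (Seq (Foreach 4 (\<lambda>_. search_body both n)) (Halt False))
      ((search_store both x y 0)(4 := replicate (Suc N) None)) b" for b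
    unfolding decide_def encode_pair_def
  proof (rule halts_Seq_right[OF _ halts_Seq_right[OF _ halts_Seq_right[OF _ that]]])
    show "runs parse (input_store (map Some x @ [None] @ map Some y)) (parsed_store x y)"
      using runs_parse by simp
    show "runs (append_inverse 1 2) (parsed_store x y) (search_store both x y 0)"
      by (rule runs_append_inverse[where v = x and w = "[]"])
        (auto simp: parsed_store_def search_store_def fun_eq_iff power_word_def)
    show "runs (set_counter B) (search_store both x y 0)
        ((search_store both x y 0)(4 := replicate (Suc N) None))"
      by (rule runs_set_counter) (auto simp: search_store_def N_def)
  qed
  have step: "runs (search_body both n) ((search_store both x y (length p))(4 := c))
      ((search_store both x y (length (p @ [a])))(4 := c))"
    if "\<not> found both n x y (length p)" for p :: "letter option list" and a c
    using search_body(2)[OF assms that] by simp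
  show ?thesis
  proof (cases "\<exists>k\<le>N. found both n x y k")
    case True
    \<comment> \<open>All rounds before the successful one must run to completion, so the least
      successful exponent is taken.\<close>
    define k where "k = (LEAST k. found both n x y k)"
    obtain k0 where k0: "k0 \<le> N" "found both n x y k0"
      using True by blast
    have k: "found both n x y k" "k \<le> N"
      using LeastI[of "found both n x y" k0] Least_le[of "found both n x y" k0] k0
      by (auto simp: k_def)
    have less: "\<not> found both n x y j" if "j < k" for j
      using that not_less_Least by (auto simp: k_def)
    have "halts (Foreach 4 (\<lambda>_. search_body both n))
      ((search_store both x y 0)(4 := replicate (Suc N) None)) True"
    proof (rule halts_For[where G = "\<lambda>p. search_store both x y (length p)"
          and l = "replicate k None" and a = None and r = "replicate (N - k) None"])
      have "replicate (Suc N) None = replicate (k + Suc (N - k)) (None :: letter option)"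
        using k(2) by simp
      then show "(search_store both x y 0)(4 := replicate (Suc N) None)
        = (search_store both x y (length []))(4 := replicate k None @ None # replicate (N - k) None)"
        by (simp only: replicate_add replicate_Suc list.size)
    next
      fix p z q
      assume "replicate k None = p @ z # (q :: letter option list)"
      from arg_cong[OF this, of length] have "length p < k"
        by simp
      then show "runs (search_body both n)
          ((search_store both x y (length p))(4 := q @ None # replicate (N - k) None))
          ((search_store both x y (length (p @ [z])))(4 := q @ None # replicate (N - k) None))"
        by (intro step less)
    qed (use search_body(1)[OF assms k(1)] in simp_all)
    then have "halts (decide both B n) (input_store (encode_pair x y)) True"
      by (intro prefix halts_Seq_left)
    then show ?thesis
      using True by (simp only: N_def simp_thms)
  next
    case False
    have "runs (Foreach 4 (\<lambda>_. search_body both n))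
      ((search_store both x y 0)(4 := replicate (Suc N) None))
      ((search_store both x y (Suc N))(4 := []))"
    proof (rule runs_For[where G = "\<lambda>p. search_store both x y (length p)"
          and l = "replicate (Suc N) None" and r = "[]"])
      fix p z q
      assume "replicate (Suc N) None = p @ z # (q :: letter option list)"
      from arg_cong[OF this, of length] have "length p \<le> N"
        by simp
      then show "runs (search_body both n) ((search_store both x y (length p))(4 := q @ []))
          ((search_store both x y (length (p @ [z])))(4 := q @ []))"
        using False by (intro step) auto
    qed simp_all
    then have "halts (decide both B n) (input_store (encode_pair x y)) False"
      by (intro prefix halts_Seq_right halts_Halt)
    then show ?thesis
      using False by (simp only: N_def simp_thms)
  qed
qed

text \<open>Braid words and free group words use the same letters. Artin's automorphism for the last
  braid generator involves \<open>gen n\<close>, so indices up to \<open>n\<close> occur although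
  the input stops at \<open>n - 1\<close>.\<close>

definition work_alphabet :: "nat \<Rightarrow> letter option tape_symbol set" where
  "work_alphabet n = insert Blank (Input ` insert None (Some ` ({0..n} \<times> UNIV)))"

lemma work_alphabet_simps [simp]: "Blank \<in> work_alphabet n" "Input None \<in> work_alphabet n"
  "Input (Some l) \<in> work_alphabet n \<longleftrightarrow> fst l \<le> n"
  by (auto simp: work_alphabet_def image_iff mem_Times_iff)

lemma fst_art: "fst l < n \<Longrightarrow> fst a \<le> n \<Longrightarrow> b \<in> set (art l a) \<Longrightarrow> fst b \<le> n"
  by (cases a; cases "(l, fst a)" rule: art_gen.cases)
    (auto simp: art_def winv_def split: if_splits)

lemma wf_subst_com: "fst l < n \<Longrightarrow> wf_com 11 (work_alphabet n) (subst_com l)"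
  unfolding subst_com_def
  by (auto intro!: wf_For wf_move wf_pushes split: option.split) (metis fst_art fst_conv)

lemma wf_test_gen:
  assumes "z < 11" "i \<le> n"
  shows "wf_com 11 (work_alphabet n) (test_gen n z i)"
  unfolding test_gen_def push_com_def
  using assms by (auto intro!: wf_For wf_traverse wf_clear wf_subst_com split: option.split)

lemma wf_accept_if_trivial:
  assumes "z < 11"
  shows "wf_com 11 (work_alphabet n) (accept_if_trivial n z)"
proof -
  have "wf_com 11 (work_alphabet n) (test_gens n z is)" if "\<forall>i\<in>set is. i \<le> n" for "is"
    using that assms by (induction "is") (auto intro: wf_test_gen)
  then show ?thesis
    unfolding accept_if_trivial_def by (auto intro!: wf_clear simp del: upt_Suc)
qed

lemma wf_append_inverse:
  "i < 11 \<Longrightarrow> j < 11 \<Longrightarrow> wf_com 11 (work_alphabet n) (append_inverse i j)"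
  unfolding append_inverse_def
  by (rule wf_traverse) (auto simp: work_alphabet_def)

lemma wf_decide: "wf_com 11 (work_alphabet n) (decide both B n)"
  unfolding decide_def parse_def search_body_def check_and_multiply_def set_counter_def
    multiply_counter_def
  by (auto intro!: wf_For wf_traverse wf_move wf_pushes wf_accept_if_trivial wf_append_inverse)

section \<open>From bounded search to decidability on encoded pairs\<close>

lemma separator_cases:
  obtains x where "w = map Some x"
  | x y where "w = encode_pair x y"
  | x y r where "w = map Some x @ None # map Some y @ None # r"
proof -
  have split: "(\<exists>x. w = map Some x) \<or> (\<exists>x r. w = map Some x @ None # r)" for w :: "'a option list"
  proof (induction w)
    case (Cons a w)
    show ?case
    proof (cases a)
      case None
      then show ?thesis
        by (metis append_Nil list.map(1))
    next
      case (Some b)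
      from Cons show ?thesis
      proof (elim disjE exE)
        fix x
        assume "w = map Some x"
        then have "a # w = map Some (b # x)"
          using Some by simp
        then show ?thesis
          by (rule disjI1[OF exI])
      next
        fix x r
        assume "w = map Some x @ None # r"
        then have "a # w = map Some (b # x) @ None # r"
          using Some by simp
        then show ?thesis
          by (intro disjI2 exI)
      qed
    qed
  qed simp
  from split[of w] show ?thesis
  proof (elim disjE exE)
    fix x r
    assume w: "w = map Some x @ None # r"
    from split[of r] show ?thesis
      using that w unfolding encode_pair_def by auto
  qed (rule that)
qed

lemma encode_pair_inject:
  "map Some x @ None # r = map Some x' @ None # r' \<Longrightarrow> x = x' \<and> r = r'"
proof (induction x arbitrary: x')
  case Nil
  then show ?case
    by (cases x') auto
next
  case (Cons a x)
  then show ?case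
    by (cases x') auto
qed

lemma decidable_on_pairs_bounded_search:
  assumes "\<And>x y. x \<in> braid_words n \<Longrightarrow> y \<in> braid_words n \<Longrightarrow>
    P x y \<longleftrightarrow> (\<exists>k\<le>B ^ Suc (length y). found both n x y k)"
  shows "decidable_on_pairs (letters (braid_gens n)) P"
  unfolding decidable_on_pairs_def
proof (rule decidable_languageI[where S = "work_alphabet n" and k = 11 and c = "decide both B n"])
  let ?A = "letters (braid_gens n)"
  let ?L = "{encode_pair x y | x y. x \<in> lists ?A \<and> y \<in> lists ?A \<and> P x y}"
  show "finite (insert None (Some ` ?A))"
    by (simp add: letters_def braid_gens_def)
  show "?L \<subseteq> lists (insert None (Some ` ?A))"
    by (auto simp: encode_pair_def)
  show "finite (work_alphabet n)"
    by (simp add: work_alphabet_def)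
  show "insert Blank (Input ` insert None (Some ` ?A)) \<subseteq> work_alphabet n"
    by (auto simp: letters_def braid_gens_def)
  show "wf_com 11 (work_alphabet n) (decide both B n)"
    by (rule wf_decide)
  fix w
  assume w: "w \<in> lists (insert None (Some ` ?A))"
  have store: "(\<lambda>i. if i = 0 then w else []) = input_store w"
    by (simp add: input_store_def fun_eq_iff)
  show "halts (decide both B n) (\<lambda>i. if i = 0 then w else []) (w \<in> ?L)"
  proof (cases w rule: separator_cases)
    case (1 x)
    have "None \<notin> set w"
      using 1 by auto
    then have "w \<notin> ?L"
      by (auto simp: encode_pair_def)
    moreover have "halts (decide both B n) (input_store w) False"
      unfolding decide_def 1 by (rule halts_Seq_left[OF parse_no_separator])
    ultimately show ?thesis
      by (simp only: store)
  next
    case (2 x y)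
    have xy: "x \<in> braid_words n" "y \<in> braid_words n"
      using w 2 by (auto simp: encode_pair_def)
    have "x = x' \<and> y = y'" if "encode_pair x y = encode_pair x' y'" for x' y'
      using that encode_pair_inject[of x "map Some y" x' "map Some y'"]
      by (simp add: encode_pair_def inj_map_eq_map)
    then have "w \<in> ?L \<longleftrightarrow> P x y"
      unfolding 2 using xy by auto
    then show ?thesis
      unfolding store using halts_decide[OF xy, of both B] assms[OF xy] by (simp only: 2)
  next
    case (3 x y r)
    have "w \<notin> ?L"
    proof
      assume "w \<in> ?L"
      then obtain x' y' where "w = encode_pair x' y'"
        by blast
      then have "map Some y @ None # r = map Some y'"
        using encode_pair_inject[of x _ x'] unfolding 3 encode_pair_def by simp
      then have "None \<in> set (map Some y')"
        by (metis in_set_conv_decomp)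
      then show False
        by auto
    qed
    moreover have "halts (decide both B n) (input_store w) False"
      unfolding decide_def 3 by (rule halts_Seq_left[OF parse_two_separators])
    ultimately show ?thesis
      by (simp only: store)
  qed
qed simp

theorem corollary2p4:
  fixes n :: nat
  assumes "n \<ge> 1"
  shows "braid_power_orbit_decidable n \<and> braid_nonneg_power_orbit_decidable n"
proof
  obtain C where C: "\<And>x y. x \<in> braid_words n \<Longrightarrow> y \<in> braid_words n \<Longrightarrow>
    in_nonneg_power_orbit (braid_group n) (braid_of_word n x) (braid_of_word n y) \<longleftrightarrow>
    (\<exists>k\<le>C ^ Suc (length y). acts_trivially n (power_word x y k))"
    using nonneg_power_orbit_bounded[of n] unfolding power_word_def by blast
  show "braid_nonneg_power_orbit_decidable n"
    unfolding braid_nonneg_power_orbit_decidable_def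
    by (rule decidable_on_pairs_bounded_search[where both = False and B = C])
      (simp add: C found_def)
  show "braid_power_orbit_decidable n"
    unfolding braid_power_orbit_decidable_def
  proof (rule decidable_on_pairs_bounded_search[where both = True and B = C])
    fix x y
    assume "x \<in> braid_words n" "y \<in> braid_words n"
    \<comment> \<open>The bound on the exponent depends on \<open>y\<close> alone, so the same
      \<open>C\<close> serves \<open>x\<close> and \<open>winv x\<close>.\<close>
    then show "in_power_orbit (braid_group n) (braid_of_word n x) (braid_of_word n y) \<longleftrightarrow>
        (\<exists>k\<le>C ^ Suc (length y). found True n x y k)"
      using C[of x y] C[of "winv x" y] by (auto simp: in_power_orbit_iff found_def)
  qed
qed

end
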